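(* For every group $G$ the following assertions are equivalent: (i) Every proper normal subgroup of $G$ has infinite index. (ii) The trivial one is the only positive and bounded representation of $G$ with a quasi-interior fixed point on any atomic Banach lattice with order continuous norm; that is, whenever $E$ is an atomic Banach lattice with order continuous norm and $(T_t)_{t\in G}$ is a positive and bounded group representation of $G$ on $E$ which possesses a quasi-interior fixed point, then $T_t=\mathrm{id}_E$ for all $t\in G$.
   Context: All Banach lattices are real. A subgroup of $G$ is proper if it does not coincide with $G$; the index of a normal subgroup $N$ is the cardinality of $G/N$. A group representation of $G$ on a Banach space $E$ is a family $(T_t)_{t\in G}$ of invertible operators in $\mathcal L(E)$ with $T_{ts}=T_tT_s$ for all $t,s\in G$ (no topology on $G$ and no continuity is assumed). It is bounded if $\sup_{t\in G}\|T_t\|<\infty$; if $E$ is a Banach lattice, it is positive if each $T_t$ maps $E_+$ into $E_+$. A vector $y\in E_+$ is a quasi-interior point of $E_+$ if the principal ideal $E_y=\{g\in E:\exists c\ge0,\ |g|\le cy\}$ is dense in $E$. A quasi-interior fixed point of $(T_t)_{t\in G}$ is a quasi-interior point $y$ of $E_+$ with $T_ty=y$ for all $t\in G$. An element $a\in E_+$ is an atom if its principal ideal $E_a$ is one-dimensional. $E$ is atomic if the band generated by all atoms equals $E$. *)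

theory Defs
  imports Complex_Main "HOL-Algebra.Coset" "HOL-Algebra.Lattice"
begin

section \<open>Banach lattices\<close>

text \<open>
  The statement quantifies over all Banach lattices, so a Banach lattice cannot be a type of some
  class here. It is instead a term: its underlying vector space is a linear subspace \<open>carrier E\<close> of
  an ambient type \<open>'v::real_vector\<close>, and its order and norm are arbitrary and part of the structure
  (values outside \<open>carrier E\<close> are irrelevant). Every real vector space is, up to isomorphism, a
  subspace of some infinite-dimensional type of this kind.
\<close>

record 'v normed_order = "'v gorder" +
  nrm :: "'v \<Rightarrow> real"

definition modulus :: "('v::real_vector, 'b) gorder_scheme \<Rightarrow> 'v \<Rightarrow> 'v" where
  "modulus E x = x \<squnion>\<^bsub>E\<^esub> (- x)"

definition pos_cone :: "('v::real_vector, 'b) gorder_scheme \<Rightarrow> 'v set" where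
  "pos_cone E = {x \<in> carrier E. 0 \<sqsubseteq>\<^bsub>E\<^esub> x}"

locale banach_lattice = lattice E for E :: "'v::real_vector normed_order" (structure) +
  assumes subspace_carrier: "subspace (carrier E)"
    and add_right_mono:
      "\<lbrakk>x \<in> carrier E; y \<in> carrier E; z \<in> carrier E; x \<sqsubseteq> y\<rbrakk> \<Longrightarrow> x + z \<sqsubseteq> y + z"
    and scaleR_left_mono:
      "\<lbrakk>x \<in> carrier E; y \<in> carrier E; 0 \<le> c; x \<sqsubseteq> y\<rbrakk> \<Longrightarrow> c *\<^sub>R x \<sqsubseteq> c *\<^sub>R y"
    and nrm_eq_0_iff: "x \<in> carrier E \<Longrightarrow> nrm E x = 0 \<longleftrightarrow> x = 0"
    and nrm_triangle: "\<lbrakk>x \<in> carrier E; y \<in> carrier E\<rbrakk> \<Longrightarrow> nrm E (x + y) \<le> nrm E x + nrm E y"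
    and nrm_scaleR: "x \<in> carrier E \<Longrightarrow> nrm E (c *\<^sub>R x) = \<bar>c\<bar> * nrm E x"
    and nrm_mono:
      "\<lbrakk>x \<in> carrier E; y \<in> carrier E; modulus E x \<sqsubseteq> modulus E y\<rbrakk> \<Longrightarrow> nrm E x \<le> nrm E y"
    and nrm_complete:
      "\<lbrakk>\<And>n. \<sigma> n \<in> carrier E; \<forall>\<epsilon>>0. \<exists>N. \<forall>m\<ge>N. \<forall>n\<ge>N. nrm E (\<sigma> m - \<sigma> n) < \<epsilon>\<rbrakk>
        \<Longrightarrow> \<exists>x\<in>carrier E. (\<lambda>n::nat. nrm E (\<sigma> n - x)) \<longlonglongrightarrow> 0"

definition principal_ideal :: "('v::real_vector, 'b) gorder_scheme \<Rightarrow> 'v \<Rightarrow> 'v set" where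
  "principal_ideal E y = {g \<in> carrier E. \<exists>c\<ge>0. modulus E g \<sqsubseteq>\<^bsub>E\<^esub> c *\<^sub>R y}"

definition dense_in :: "'v::real_vector normed_order \<Rightarrow> 'v set \<Rightarrow> bool" where
  "dense_in E A \<longleftrightarrow> (\<forall>x\<in>carrier E. \<forall>\<epsilon>>0. \<exists>g\<in>A. nrm E (x - g) < \<epsilon>)"

definition quasi_interior :: "'v::real_vector normed_order \<Rightarrow> 'v \<Rightarrow> bool" where
  "quasi_interior E y \<longleftrightarrow> y \<in> pos_cone E \<and> dense_in E (principal_ideal E y)"

definition atom :: "('v::real_vector, 'b) gorder_scheme \<Rightarrow> 'v \<Rightarrow> bool" where
  "atom E a \<longleftrightarrow> a \<in> pos_cone E \<and> dim (principal_ideal E a) = 1"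

definition order_ideal :: "('v::real_vector, 'b) gorder_scheme \<Rightarrow> 'v set \<Rightarrow> bool" where
  "order_ideal E I \<longleftrightarrow> I \<subseteq> carrier E \<and> subspace I \<and>
     (\<forall>y\<in>I. \<forall>x\<in>carrier E. modulus E x \<sqsubseteq>\<^bsub>E\<^esub> modulus E y \<longrightarrow> x \<in> I)"

definition band :: "('v::real_vector, 'b) gorder_scheme \<Rightarrow> 'v set \<Rightarrow> bool" where
  "band E B \<longleftrightarrow> order_ideal E B \<and> (\<forall>A s. A \<subseteq> B \<longrightarrow> least E s (Upper E A) \<longrightarrow> s \<in> B)"

definition atomic :: "('v::real_vector, 'b) gorder_scheme \<Rightarrow> bool" where
  "atomic E \<longleftrightarrow> band E hull {a. atom E a} = carrier E"

text \<open>
  Every net decreasing to \<open>0\<close> converges to \<open>0\<close> in norm; a decreasing net is given by its range, a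
  downward directed set \<open>D\<close> with infimum \<open>0\<close>, indexed by itself.
\<close>

definition order_continuous_norm :: "'v::real_vector normed_order \<Rightarrow> bool" where
  "order_continuous_norm E \<longleftrightarrow>
     (\<forall>D. D \<subseteq> carrier E \<longrightarrow> D \<noteq> {} \<longrightarrow>
        (\<forall>x\<in>D. \<forall>y\<in>D. \<exists>z\<in>D. z \<sqsubseteq>\<^bsub>E\<^esub> x \<and> z \<sqsubseteq>\<^bsub>E\<^esub> y) \<longrightarrow>
        greatest E 0 (Lower E D) \<longrightarrow>
        (\<forall>\<epsilon>>0. \<exists>x\<in>D. \<forall>y\<in>D. y \<sqsubseteq>\<^bsub>E\<^esub> x \<longrightarrow> nrm E y < \<epsilon>))"

section \<open>Group representations\<close>

text \<open>Operators on \<open>E\<close> are functions on the ambient type of which only the restriction to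
  \<open>carrier E\<close> matters.\<close>

definition bounded_operator :: "'v::real_vector normed_order \<Rightarrow> ('v \<Rightarrow> 'v) \<Rightarrow> bool" where
  "bounded_operator E S \<longleftrightarrow>
     (\<forall>x\<in>carrier E. S x \<in> carrier E) \<and>
     (\<forall>x\<in>carrier E. \<forall>y\<in>carrier E. S (x + y) = S x + S y) \<and>
     (\<forall>c. \<forall>x\<in>carrier E. S (c *\<^sub>R x) = c *\<^sub>R S x) \<and>
     (\<exists>K. \<forall>x\<in>carrier E. nrm E (S x) \<le> K * nrm E x)"

definition operator_norm :: "'v::real_vector normed_order \<Rightarrow> ('v \<Rightarrow> 'v) \<Rightarrow> real" where
  "operator_norm E S = (SUP x\<in>{x \<in> carrier E. nrm E x \<le> 1}. nrm E (S x))"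

definition invertible_operator :: "'v::real_vector normed_order \<Rightarrow> ('v \<Rightarrow> 'v) \<Rightarrow> bool" where
  "invertible_operator E S \<longleftrightarrow> bounded_operator E S \<and>
     (\<exists>R. bounded_operator E R \<and> (\<forall>x\<in>carrier E. R (S x) = x \<and> S (R x) = x))"

definition representation ::
    "('g, 'm) monoid_scheme \<Rightarrow> 'v::real_vector normed_order \<Rightarrow> ('g \<Rightarrow> 'v \<Rightarrow> 'v) \<Rightarrow> bool" where
  "representation G E T \<longleftrightarrow>
     (\<forall>t\<in>carrier G. invertible_operator E (T t)) \<and>
     (\<forall>t\<in>carrier G. \<forall>s\<in>carrier G. \<forall>x\<in>carrier E. T (t \<otimes>\<^bsub>G\<^esub> s) x = T t (T s x))"

definition bounded_representation ::
    "('g, 'm) monoid_scheme \<Rightarrow> 'v::real_vector normed_order \<Rightarrow> ('g \<Rightarrow> 'v \<Rightarrow> 'v) \<Rightarrow> bool" where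
  "bounded_representation G E T \<longleftrightarrow>
     representation G E T \<and> bdd_above ((\<lambda>t. operator_norm E (T t)) ` carrier G)"

definition positive_representation ::
    "('g, 'm) monoid_scheme \<Rightarrow> 'v::real_vector normed_order \<Rightarrow> ('g \<Rightarrow> 'v \<Rightarrow> 'v) \<Rightarrow> bool" where
  "positive_representation G E T \<longleftrightarrow>
     representation G E T \<and> (\<forall>t\<in>carrier G. \<forall>x\<in>pos_cone E. T t x \<in> pos_cone E)"

definition quasi_interior_fixed_point ::
    "('g, 'm) monoid_scheme \<Rightarrow> 'v::real_vector normed_order \<Rightarrow> ('g \<Rightarrow> 'v \<Rightarrow> 'v) \<Rightarrow> 'v \<Rightarrow> bool" where
  "quasi_interior_fixed_point G E T y \<longleftrightarrow>
     quasi_interior E y \<and> (\<forall>t\<in>carrier G. T t y = y)"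

end

theory Submission
  imports Defs
begin

text \<open>
  A positive representation acts by order automorphisms, so it permutes the atoms. If \<open>y\<close> is a
  quasi-interior fixed point and \<open>a \<le> y\<close> is an atom, two elements of the orbit of \<open>a\<close> are equal or
  disjoint: otherwise they are proportional, and powers of a group element would push multiples of
  an atom out of the order interval \<open>[0, y]\<close>. Hence all finite sums over the orbit lie below \<open>y\<close>;
  the norms on the orbit are bounded away from \<open>0\<close> by boundedness of the representation, so order
  continuity of the norm makes the orbit finite. The pointwise stabiliser of the orbit is then a
  normal subgroup of finite index, i.e. all of \<open>G\<close>, and every atom is fixed. The elements whose
  modulus dominates only fixed vectors form a band, which therefore is the whole lattice.

  Conversely, a proper normal subgroup \<open>N\<close> of finite index gives the permutation action of \<open>G\<close> on
  \<open>\<real>\<^bsup>G/N\<^esup>\<close>, which fixes the constant vectors and is not trivial.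
\<close>

subsection \<open>Banach lattices\<close>

context banach_lattice
begin

section \<open>Vector space closure and order arithmetic\<close>

lemma zero_closed [simp]: "0 \<in> carrier E"
  using subspace_carrier by (rule subspace_0)

lemma add_closed [simp]: "x \<in> carrier E \<Longrightarrow> y \<in> carrier E \<Longrightarrow> x + y \<in> carrier E"
  using subspace_carrier by (rule subspace_add)

lemma diff_closed [simp]: "x \<in> carrier E \<Longrightarrow> y \<in> carrier E \<Longrightarrow> x - y \<in> carrier E"
  using subspace_carrier by (rule subspace_diff)

lemma uminus_closed [simp]: "x \<in> carrier E \<Longrightarrow> - x \<in> carrier E"
  using subspace_carrier by (rule subspace_neg)

lemma scaleR_closed [simp]: "x \<in> carrier E \<Longrightarrow> c *\<^sub>R x \<in> carrier E"
  using subspace_carrier by (rule subspace_scale)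

lemma sum_closed: "(\<And>x. x \<in> F \<Longrightarrow> f x \<in> carrier E) \<Longrightarrow> sum f F \<in> carrier E"
  using subspace_carrier by (rule subspace_sum)

lemma add_le_cancel_right:
  "x \<in> carrier E \<Longrightarrow> y \<in> carrier E \<Longrightarrow> z \<in> carrier E \<Longrightarrow> x + z \<sqsubseteq> y + z \<longleftrightarrow> x \<sqsubseteq> y"
  using add_right_mono[of x y z] add_right_mono[of "x + z" "y + z" "- z"] by auto

lemma le_iff_diff_nonneg:
  "x \<in> carrier E \<Longrightarrow> y \<in> carrier E \<Longrightarrow> x \<sqsubseteq> y \<longleftrightarrow> 0 \<sqsubseteq> y - x"
  using add_le_cancel_right[of 0 "y - x" x] by simp

lemma diff_le_iff:
  "x \<in> carrier E \<Longrightarrow> y \<in> carrier E \<Longrightarrow> z \<in> carrier E \<Longrightarrow> x - y \<sqsubseteq> z \<longleftrightarrow> x \<sqsubseteq> z + y"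
  using add_le_cancel_right[of "x - y" z y] by simp

lemma le_diff_iff:
  "x \<in> carrier E \<Longrightarrow> y \<in> carrier E \<Longrightarrow> z \<in> carrier E \<Longrightarrow> x \<sqsubseteq> z - y \<longleftrightarrow> x + y \<sqsubseteq> z"
  using add_le_cancel_right[of x "z - y" y] by simp

lemma add_mono:
  assumes "x \<in> carrier E" "y \<in> carrier E" "z \<in> carrier E" "w \<in> carrier E" "x \<sqsubseteq> y" "z \<sqsubseteq> w"
  shows "x + z \<sqsubseteq> y + w"
proof -
  have "x + z \<sqsubseteq> y + z" using assms add_right_mono by simp
  moreover have "y + z \<sqsubseteq> y + w"
    using assms add_right_mono[of z w y] by (simp add: add.commute)
  ultimately show ?thesis
    using assms by - (rule le_trans[of "x + z" "y + z"], simp_all)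
qed

lemma add_nonneg: "x \<in> carrier E \<Longrightarrow> y \<in> carrier E \<Longrightarrow> 0 \<sqsubseteq> x \<Longrightarrow> 0 \<sqsubseteq> y \<Longrightarrow> 0 \<sqsubseteq> x + y"
  using add_mono[of 0 x 0 y] by simp

lemma scaleR_nonneg: "x \<in> carrier E \<Longrightarrow> 0 \<le> c \<Longrightarrow> 0 \<sqsubseteq> x \<Longrightarrow> 0 \<sqsubseteq> c *\<^sub>R x"
  using scaleR_left_mono[of 0 x c] by simp

lemma sum_nonneg:
  "finite F \<Longrightarrow> (\<And>x. x \<in> F \<Longrightarrow> f x \<in> carrier E \<and> 0 \<sqsubseteq> f x) \<Longrightarrow> 0 \<sqsubseteq> sum f F"
  by (induction F rule: finite_induct) (auto intro!: add_nonneg sum_closed)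

lemma uminus_le: "x \<in> carrier E \<Longrightarrow> y \<in> carrier E \<Longrightarrow> x \<sqsubseteq> y \<Longrightarrow> - y \<sqsubseteq> - x"
  using add_right_mono[of x y "- x - y"] by simp

lemma antisym_eq: "x \<in> carrier E \<Longrightarrow> y \<in> carrier E \<Longrightarrow> x \<sqsubseteq> y \<Longrightarrow> y \<sqsubseteq> x \<Longrightarrow> x = y"
  using le_antisym by blast

lemma scaleR_le_iff:
  assumes "x \<in> carrier E" "y \<in> carrier E" "0 < c"
  shows "c *\<^sub>R x \<sqsubseteq> c *\<^sub>R y \<longleftrightarrow> x \<sqsubseteq> y"
  using assms scaleR_left_mono[of x y c] scaleR_left_mono[of "c *\<^sub>R x" "c *\<^sub>R y" "inverse c"] by auto

lemma scaleR_mono_left: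
  assumes "x \<in> carrier E" "0 \<sqsubseteq> x" "c \<le> d"
  shows "c *\<^sub>R x \<sqsubseteq> d *\<^sub>R x"
  using assms scaleR_nonneg[of x "d - c"] le_iff_diff_nonneg[of "c *\<^sub>R x" "d *\<^sub>R x"]
  by (simp add: scaleR_diff_left)

section \<open>The modulus\<close>

lemma modulus_closed [simp]: "x \<in> carrier E \<Longrightarrow> modulus E x \<in> carrier E"
  by (simp add: modulus_def)

lemma le_modulus: "x \<in> carrier E \<Longrightarrow> x \<sqsubseteq> modulus E x"
  by (simp add: modulus_def join_left)

lemma uminus_le_modulus: "x \<in> carrier E \<Longrightarrow> - x \<sqsubseteq> modulus E x"
  by (simp add: modulus_def join_right)

lemma modulus_leI: "x \<in> carrier E \<Longrightarrow> y \<in> carrier E \<Longrightarrow> x \<sqsubseteq> y \<Longrightarrow> - x \<sqsubseteq> y \<Longrightarrow> modulus E x \<sqsubseteq> y"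
  by (simp add: modulus_def join_le)

lemma modulus_nonneg: 
  assumes "x \<in> carrier E"
  shows "0 \<sqsubseteq> modulus E x"
proof -
  have "x + - x \<sqsubseteq> modulus E x + modulus E x"
    using assms by (intro add_mono le_modulus uminus_le_modulus) auto
  then have "2 *\<^sub>R 0 \<sqsubseteq> 2 *\<^sub>R modulus E x"
    by (simp add: scaleR_2)
  then show ?thesis
    using assms scaleR_le_iff[of 0 "modulus E x" 2] by simp
qed

lemma modulus_of_nonneg:
  assumes "x \<in> carrier E" "0 \<sqsubseteq> x"
  shows "modulus E x = x"
proof -
  have "- x \<sqsubseteq> 0" using assms uminus_le[of 0 x] by simp
  then have "- x \<sqsubseteq> x" using assms le_trans[of "- x" 0 x] by simp
  then show ?thesis
    using assms by (intro antisym_eq modulus_leI le_modulus) auto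
qed

lemma modulus_add_le:
  assumes "x \<in> carrier E" "y \<in> carrier E"
  shows "modulus E (x + y) \<sqsubseteq> modulus E x + modulus E y"
proof (rule modulus_leI)
  show "- (x + y) \<sqsubseteq> modulus E x + modulus E y"
    using assms add_mono[of "- x" _ "- y"] by (simp add: uminus_le_modulus)
qed (use assms in \<open>auto intro: add_mono le_modulus\<close>)

lemma modulus_scaleR_le:
  assumes "x \<in> carrier E"
  shows "modulus E (c *\<^sub>R x) \<sqsubseteq> \<bar>c\<bar> *\<^sub>R modulus E x"
proof -
  have *: "\<bar>c\<bar> *\<^sub>R x \<sqsubseteq> \<bar>c\<bar> *\<^sub>R modulus E x" "\<bar>c\<bar> *\<^sub>R (- x) \<sqsubseteq> \<bar>c\<bar> *\<^sub>R modulus E x"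
    using assms by (intro scaleR_left_mono le_modulus uminus_le_modulus; simp)+
  show ?thesis
    using assms * by (cases "c \<ge> 0") (auto intro!: modulus_leI)
qed

section \<open>The lattice norm\<close>

lemma nrm_nonneg: 
  assumes "x \<in> carrier E"
  shows "0 \<le> nrm E x"
  using nrm_triangle[of x "- x"] nrm_scaleR[of x "-1"] nrm_eq_0_iff[of 0] assms by simp

lemma nrm_pos: "x \<in> carrier E \<Longrightarrow> x \<noteq> 0 \<Longrightarrow> 0 < nrm E x"
  using nrm_nonneg[of x] nrm_eq_0_iff[of x] by linarith

lemma nrm_mono_nonneg:
  assumes "x \<in> carrier E" "y \<in> carrier E" "0 \<sqsubseteq> x" "x \<sqsubseteq> y"
  shows "nrm E x \<le> nrm E y"
proof -
  have "0 \<sqsubseteq> y" using assms le_trans[of 0 x y] by simp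
  then show ?thesis using assms by (intro nrm_mono) (auto simp: modulus_of_nonneg)
qed

lemma nrm_modulus: "x \<in> carrier E \<Longrightarrow> nrm E (modulus E x) = nrm E x"
  by (intro antisym nrm_mono) (auto simp: modulus_of_nonneg modulus_nonneg)

lemma archimedean:
  assumes "x \<in> carrier E" "y \<in> carrier E" "0 \<sqsubseteq> x" and le: "\<And>n::nat. \<exists>c\<ge>real n. c *\<^sub>R x \<sqsubseteq> y"
  shows "x = 0"
proof (rule ccontr)
  assume "x \<noteq> 0"
  then have pos: "0 < nrm E x" using assms nrm_pos by simp
  obtain n :: nat where n: "nrm E y < real n * nrm E x"
    using pos reals_Archimedean3 by blast
  obtain c where c: "c \<ge> real n" "c *\<^sub>R x \<sqsubseteq> y" using le by blast
  then have "real n *\<^sub>R x \<sqsubseteq> y"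
    using assms scaleR_mono_left[of x "real n" c] by (meson le_trans scaleR_closed)
  then have "nrm E (real n *\<^sub>R x) \<le> nrm E y"
    using assms by (intro nrm_mono_nonneg scaleR_nonneg) auto
  then show False using n nrm_scaleR[of x "real n"] assms by simp
qed

text \<open>The part below \<open>x\<close> is the meet of \<open>z\<close> and \<open>x\<close>.
  The remainder lies below \<open>y\<close> because \<open>z - y\<close> is below both
  \<open>z\<close> and \<open>x\<close>, hence below their meet.\<close>

lemma riesz_decomposition:
  assumes "x \<in> carrier E" "y \<in> carrier E" "z \<in> carrier E" "0 \<sqsubseteq> x" "0 \<sqsubseteq> y" "0 \<sqsubseteq> z" "z \<sqsubseteq> x + y"
  obtains u v where "u \<in> carrier E" "v \<in> carrier E" "z = u + v" "0 \<sqsubseteq> u" "u \<sqsubseteq> x" "0 \<sqsubseteq> v" "v \<sqsubseteq> y"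
proof (rule that[of "z \<sqinter> x" "z - (z \<sqinter> x)"])
  have "0 \<sqsubseteq> z \<sqinter> x" using assms by (intro meet_le) auto
  moreover have "z - y \<sqsubseteq> z" using assms by (subst diff_le_iff) (auto intro: add_mono[of z z 0 y, simplified])
  moreover have "z - y \<sqsubseteq> x" using assms by (subst diff_le_iff) auto
  ultimately have "z - y \<sqsubseteq> z \<sqinter> x" using assms by (intro meet_le) auto
  then show "z - (z \<sqinter> x) \<sqsubseteq> y"
    using assms by (simp add: diff_le_iff add.commute)
  show "0 \<sqsubseteq> z - (z \<sqinter> x)"
    using assms by (subst le_iff_diff_nonneg[symmetric]) (auto intro: meet_left)
  show "0 \<sqsubseteq> z \<sqinter> x" by fact
qed (use assms in \<open>auto intro: meet_right\<close>)

text \<open>One half of the identity that sum equals join plus meet, with an arbitrary common upper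
  bound \<open>u\<close> in place of the join.\<close>

lemma add_diff_le_meet:
  assumes "x \<in> carrier E" "y \<in> carrier E" "u \<in> carrier E" "x \<sqsubseteq> u" "y \<sqsubseteq> u"
  shows "x + y - u \<sqsubseteq> x \<sqinter> y"
proof (rule meet_le)
  show "x + y - u \<sqsubseteq> x"
    using assms add_mono[of x x y u] by (simp add: diff_le_iff)
  show "x + y - u \<sqsubseteq> y"
    using assms add_mono[of y y x u] by (simp add: diff_le_iff add.commute)
qed (use assms in auto)

text \<open>Riesz decomposition splits the meet into a part below \<open>x\<close> and a part below
  \<open>y\<close>. Both parts are also below \<open>b\<close>, so both vanish.\<close>

lemma meet_add_eq_0:
  assumes "x \<in> carrier E" "y \<in> carrier E" "b \<in> carrier E" "0 \<sqsubseteq> x" "0 \<sqsubseteq> y" "0 \<sqsubseteq> b"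
    and "x \<sqinter> b = 0" "y \<sqinter> b = 0"
  shows "(x + y) \<sqinter> b = 0"
proof -
  define m where "m = (x + y) \<sqinter> b"
  have m: "m \<in> carrier E" "0 \<sqsubseteq> m" "m \<sqsubseteq> x + y" "m \<sqsubseteq> b"
    using assms by (auto simp: m_def intro: meet_le meet_left meet_right add_nonneg)
  then obtain u v where uv: "u \<in> carrier E" "v \<in> carrier E" "m = u + v"
    "0 \<sqsubseteq> u" "u \<sqsubseteq> x" "0 \<sqsubseteq> v" "v \<sqsubseteq> y"
    using assms riesz_decomposition[of x y m] by metis
  have "u \<sqsubseteq> m" "v \<sqsubseteq> m"
    using uv add_mono[of u u 0 v] add_mono[of 0 u v v] by auto
  then have "u \<sqsubseteq> b" "v \<sqsubseteq> b"
    using m uv assms le_trans by blast+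
  then have "u \<sqsubseteq> x \<sqinter> b" "v \<sqsubseteq> y \<sqinter> b"
    using uv assms by (auto intro: meet_le)
  then have "u = 0" "v = 0"
    using uv assms by (auto intro: antisym_eq)
  then show ?thesis using uv by (simp add: m_def)
qed

text \<open>For disjoint elements the sum acts as a join: in the induction step the partial sum is
  disjoint from the new element \<open>b\<close>, so \<open>add_diff_le_meet\<close> with upper
  bound \<open>y\<close> gives \<open>\<Sum>F + b - y\<close> \<le> 0.\<close>

lemma sum_le_of_pairwise_disjoint:
  assumes "finite F" "F \<subseteq> carrier E" "\<And>b. b \<in> F \<Longrightarrow> 0 \<sqsubseteq> b \<and> b \<sqsubseteq> y"
    and y: "y \<in> carrier E" "0 \<sqsubseteq> y"
    and "\<And>b b'. b \<in> F \<Longrightarrow> b' \<in> F \<Longrightarrow> b \<noteq> b' \<Longrightarrow> b \<sqinter> b' = 0"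
  shows "\<Sum>F \<sqsubseteq> y"
  using assms(1-3,6)
proof (induction F rule: finite_induct)
  case (insert b F)
  have sumF: "\<Sum>F \<in> carrier E" using insert.prems by (auto intro: sum_closed)
  \<comment> \<open>The nested induction runs over subsets of \<open>F\<close>, so that the
    assumptions on the elements of \<open>F\<close> stay fixed.\<close>
  have "\<Sum>H \<sqinter> b = 0" if "H \<subseteq> F" for H
    using finite_subset[OF that insert.hyps(1)] that
  proof (induction H rule: finite_induct)
    case empty
    then show ?case using insert.prems by (auto intro!: antisym_eq meet_le meet_left)
  next
    case (insert h H)
    then have hH: "h \<in> F" "H \<subseteq> F" by auto
    have "(h + \<Sum>H) \<sqinter> b = 0"
    proof (rule meet_add_eq_0)
      show "\<Sum>H \<in> carrier E" using hH \<open>insert b F \<subseteq> carrier E\<close> by (intro sum_closed) auto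
      show "0 \<sqsubseteq> \<Sum>H"
        using hH insert.hyps insert.prems \<open>insert b F \<subseteq> carrier E\<close> 
          \<open>\<And>c. c \<in> insert b F \<Longrightarrow> 0 \<sqsubseteq> c \<and> c \<sqsubseteq> y\<close>
        by (intro sum_nonneg) auto
      show "h \<sqinter> b = 0" using hH \<open>b \<notin> F\<close>
          \<open>\<And>c c'. c \<in> insert b F \<Longrightarrow> c' \<in> insert b F \<Longrightarrow> c \<noteq> c' \<Longrightarrow> c \<sqinter> c' = 0\<close> by auto
    qed (use insert hH \<open>insert b F \<subseteq> carrier E\<close> 
          \<open>\<And>c. c \<in> insert b F \<Longrightarrow> 0 \<sqsubseteq> c \<and> c \<sqsubseteq> y\<close> in auto)
    then show ?case using insert by simp
  qed
  then have "\<Sum>F \<sqinter> b = 0" by simp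
  moreover have "\<Sum>F \<sqsubseteq> y" using insert by auto
  ultimately have "\<Sum>F + b - y \<sqsubseteq> 0"
    using add_diff_le_meet[of "\<Sum>F" b y] sumF y insert.prems by auto
  then show ?case
    using insert.prems insert.hyps sumF y by (simp add: diff_le_iff add.commute)
qed (use y in auto)

end

subsection \<open>Atoms and the band of fixed vectors\<close>

text \<open>Order-theoretic form of an atom, free of dimensions, which carries over directly along
  positive maps with positive inverse.\<close>

definition minimal_positive :: "('v::real_vector, 'b) gorder_scheme \<Rightarrow> 'v \<Rightarrow> bool" where
  "minimal_positive E a \<longleftrightarrow> a \<in> carrier E \<and> 0 \<sqsubseteq>\<^bsub>E\<^esub> a \<and> a \<noteq> 0 \<and>
     (\<forall>z\<in>carrier E. 0 \<sqsubseteq>\<^bsub>E\<^esub> z \<longrightarrow> z \<sqsubseteq>\<^bsub>E\<^esub> a \<longrightarrow> (\<exists>c. z = c *\<^sub>R a))"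

lemma minimal_positiveD:
  assumes "minimal_positive E a" "z \<in> carrier E" "0 \<sqsubseteq>\<^bsub>E\<^esub> z" "z \<sqsubseteq>\<^bsub>E\<^esub> a"
  obtains c where "z = c *\<^sub>R a"
  using assms by (auto simp: minimal_positive_def)

context banach_lattice
begin

lemma modulus_le_0_imp_eq_0:
  assumes "x \<in> carrier E" "modulus E x \<sqsubseteq> 0"
  shows "x = 0"
proof -
  have "modulus E x = 0" using assms by (intro antisym_eq modulus_nonneg) auto
  then show ?thesis using assms nrm_modulus nrm_eq_0_iff by (metis zero_closed)
qed

text \<open>Dimension 1 means that the principal ideal spans a line, and this ideal contains the
  order interval from 0 to \<open>a\<close>. If \<open>a\<close> were 0, the ideal would be zero and
  could not span a line.\<close>

lemma atom_imp_minimal_positive: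
  assumes "atom E a"
  shows "minimal_positive E a"
proof -
  define P where "P = principal_ideal E a"
  have a: "a \<in> carrier E" "0 \<sqsubseteq> a" and dim: "dim P = 1"
    using assms by (auto simp: atom_def pos_cone_def P_def)
  obtain B where B: "independent B" "span B = span P" "card B = 1"
    using dim unfolding real_vector.dim_def by (metis (mono_tags, lifting) someI_ex zero_neq_one)
  then obtain e where e: "B = {e}" by (auto simp: card_1_singleton_iff)
  have multiple: "\<exists>c. z = c *\<^sub>R e" if "z \<in> P" for z
    using that B e span_superset[of P] by (auto simp: span_singleton)
  have mem: "z \<in> P" if "z \<in> carrier E" "0 \<sqsubseteq> z" "z \<sqsubseteq> a" for z
    unfolding P_def principal_ideal_def using that a
    by (auto simp: modulus_of_nonneg intro!: exI[of _ 1])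
  have "a \<noteq> 0"
  proof
    assume "a = 0"
    then have "P \<subseteq> {0}"
      by (auto simp: P_def principal_ideal_def intro: modulus_le_0_imp_eq_0)
    then have "span B \<subseteq> {0}"
      using B(2) by (simp add: span_minimal subspace_single_0)
    then show False
      using B(1) e by (metis dependent_zero insertI1 singletonD span_base subsetD)
  qed
  moreover have "\<exists>c. z = c *\<^sub>R a" if z: "z \<in> carrier E" "0 \<sqsubseteq> z" "z \<sqsubseteq> a" for z
  proof -
    obtain k c where k: "a = k *\<^sub>R e" and c: "z = c *\<^sub>R e"
      using multiple mem z a le_refl by metis
    then have "z = (c / k) *\<^sub>R a" using \<open>a \<noteq> 0\<close> by auto
    then show ?thesis ..
  qed
  ultimately show ?thesis using a by (auto simp: minimal_positive_def)
qed

lemma scaleR_nonneg_imp: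
  assumes "a \<in> carrier E" "0 \<sqsubseteq> a" "a \<noteq> 0" "0 \<sqsubseteq> c *\<^sub>R a"
  shows "0 \<le> c"
proof (rule ccontr)
  assume "\<not> 0 \<le> c"
  then have "c < 0" by simp
  then have "0 \<sqsubseteq> (- inverse c) *\<^sub>R c *\<^sub>R a" using assms by - (rule scaleR_nonneg, auto)
  moreover have "(- inverse c) *\<^sub>R c *\<^sub>R a = - a" using \<open>c < 0\<close> by simp
  ultimately have "0 \<sqsubseteq> - a" by simp
  then have "a \<sqsubseteq> 0" using assms uminus_le[of 0 "- a"] by simp
  then show False using assms antisym_eq by auto
qed

lemma minimal_positive_scaleR:
  assumes "minimal_positive E a" "c > 0"
  shows "minimal_positive E (c *\<^sub>R a)"
proof -
  have "\<exists>d. z = d *\<^sub>R c *\<^sub>R a" if z: "z \<in> carrier E" "0 \<sqsubseteq> z" "z \<sqsubseteq> c *\<^sub>R a" for z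
  proof -
    have d: "inverse c *\<^sub>R z \<sqsubseteq> inverse c *\<^sub>R c *\<^sub>R a" "0 \<sqsubseteq> inverse c *\<^sub>R z"
      using assms z by (intro scaleR_left_mono scaleR_nonneg; simp add: minimal_positive_def)+
    then obtain d where "inverse c *\<^sub>R z = d *\<^sub>R a"
      using minimal_positiveD[OF assms(1), of "inverse c *\<^sub>R z"] assms(2) z d by auto
    then have "c *\<^sub>R inverse c *\<^sub>R z = d *\<^sub>R c *\<^sub>R a" by (simp only: scaleR_left_commute)
    then show ?thesis using assms(2) by auto
  qed
  then show ?thesis using assms by (auto simp: minimal_positive_def intro: scaleR_nonneg)
qed

text \<open>Density yields \<open>g\<close> in the ideal of \<open>y\<close> that is closer to
  \<open>a\<close> than the norm of \<open>a\<close>. Then the meet of \<open>a\<close> with the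
  modulus of \<open>g\<close> is nonzero; it is a multiple of \<open>a\<close> by minimality and
  lies below a multiple of \<open>y\<close>.\<close>

lemma minimal_positive_le_quasi_interior:
  assumes a: "minimal_positive E a" and y: "quasi_interior E y"
  obtains c where "c > 0" "c *\<^sub>R a \<sqsubseteq> y"
proof -
  have aE: "a \<in> carrier E" "0 \<sqsubseteq> a" "a \<noteq> 0" using a by (auto simp: minimal_positive_def)
  have yE: "y \<in> carrier E" "0 \<sqsubseteq> y" using y by (auto simp: quasi_interior_def pos_cone_def)
  have "dense_in E (principal_ideal E y)" using y by (simp add: quasi_interior_def)
  then obtain g where g: "g \<in> principal_ideal E y" "nrm E (a - g) < nrm E a"
    using aE nrm_pos[of a] unfolding dense_in_def by blast
  then obtain k where k: "g \<in> carrier E" "k \<ge> 0" "modulus E g \<sqsubseteq> k *\<^sub>R y"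
    by (auto simp: principal_ideal_def)
  define m where "m = a \<sqinter> modulus E g"
  have m: "m \<in> carrier E" "0 \<sqsubseteq> m" "m \<sqsubseteq> a" "m \<sqsubseteq> modulus E g"
    using aE k by (auto simp: m_def intro: meet_le meet_left meet_right modulus_nonneg)
  \<comment> \<open>Otherwise \<open>a - d\<close>, with \<open>d\<close> the modulus of
    \<open>a - g\<close>, is below both \<open>a\<close> and the modulus of \<open>g\<close>, hence
    below 0. Then \<open>a\<close> \<le> \<open>d\<close> contradicts the choice of
    \<open>g\<close>.\<close>
  have "m \<noteq> 0"
  proof
    assume "m = 0"
    define d where "d = modulus E (a - g)"
    have d: "d \<in> carrier E" "0 \<sqsubseteq> d" using aE k by (auto simp: d_def modulus_nonneg)
    have "a \<sqsubseteq> d + modulus E g"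
      using aE k add_mono[of "a - g" d g "modulus E g"] by (simp add: d_def le_modulus)
    then have "a - d \<sqsubseteq> modulus E g" using aE k d by (simp add: diff_le_iff add.commute)
    moreover have "a - d \<sqsubseteq> a" using aE d add_mono[of a a 0 d] by (simp add: diff_le_iff)
    ultimately have "a - d \<sqsubseteq> m" using aE d k by (auto simp: m_def intro: meet_le)
    then have "a \<sqsubseteq> d" using \<open>m = 0\<close> aE d by (simp add: diff_le_iff)
    then have "nrm E a \<le> nrm E d" using aE d by (intro nrm_mono_nonneg) auto
    then show False using g aE k by (simp add: d_def nrm_modulus)
  qed
  moreover obtain c where c: "m = c *\<^sub>R a" using a m by (auto simp: minimal_positive_def)
  ultimately have "c > 0" using scaleR_nonneg_imp[of a c] aE m by fastforce
  have "m \<sqsubseteq> k *\<^sub>R y" using m k yE by - (rule le_trans[of m "modulus E g"], simp_all)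
  \<comment> \<open>\<open>k\<close> is only known to be nonnegative; \<open>k + 1\<close> can be
    divided by.\<close>
  also have "k *\<^sub>R y \<sqsubseteq> (k + 1) *\<^sub>R y" using yE by (intro scaleR_mono_left) auto
  finally have "c *\<^sub>R a \<sqsubseteq> (k + 1) *\<^sub>R y" using yE m c by simp
  then have "inverse (k + 1) *\<^sub>R c *\<^sub>R a \<sqsubseteq> inverse (k + 1) *\<^sub>R (k + 1) *\<^sub>R y"
    using k aE yE by (intro scaleR_left_mono) auto
  then show ?thesis using that[of "inverse (k + 1) * c"] k \<open>c > 0\<close> by simp
qed

end

section \<open>Positive group actions and the band of fixed vectors\<close>

locale positive_action = banach_lattice E + G: group G
  for E :: "'v::real_vector normed_order" (structure) and G :: "('g, 'm) monoid_scheme" +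
  fixes T :: "'g \<Rightarrow> 'v \<Rightarrow> 'v"
  assumes positive_representation: "positive_representation G E T"
begin

lemma bounded_operator: "t \<in> carrier G \<Longrightarrow> bounded_operator E (T t)"
  using positive_representation
  by (simp add: positive_representation_def representation_def invertible_operator_def)

lemma T_closed [simp]: "t \<in> carrier G \<Longrightarrow> x \<in> carrier E \<Longrightarrow> T t x \<in> carrier E"
  and T_add: "t \<in> carrier G \<Longrightarrow> x \<in> carrier E \<Longrightarrow> y \<in> carrier E \<Longrightarrow> T t (x + y) = T t x + T t y"
  and T_scaleR: "t \<in> carrier G \<Longrightarrow> x \<in> carrier E \<Longrightarrow> T t (c *\<^sub>R x) = c *\<^sub>R T t x"
  using bounded_operator by (auto simp: bounded_operator_def)

lemma T_diff: "t \<in> carrier G \<Longrightarrow> x \<in> carrier E \<Longrightarrow> y \<in> carrier E \<Longrightarrow> T t (x - y) = T t x - T t y"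
  using T_add[of t "x - y" y] by simp

lemma T_mult:
  "t \<in> carrier G \<Longrightarrow> s \<in> carrier G \<Longrightarrow> x \<in> carrier E \<Longrightarrow> T (t \<otimes>\<^bsub>G\<^esub> s) x = T t (T s x)"
  using positive_representation by (simp add: positive_representation_def representation_def)

text \<open>The operator of the unit is idempotent by multiplicativity, and an invertible idempotent
  is the identity.\<close>

lemma T_one: 
  assumes "x \<in> carrier E"
  shows "T \<one>\<^bsub>G\<^esub> x = x"
proof -
  obtain R where R: "\<forall>x\<in>carrier E. R (T \<one>\<^bsub>G\<^esub> x) = x"
    using positive_representation G.one_closed
    unfolding positive_representation_def representation_def invertible_operator_def by metis
  have "R (T \<one>\<^bsub>G\<^esub> (T \<one>\<^bsub>G\<^esub> x)) = R (T \<one>\<^bsub>G\<^esub> x)"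
    using T_mult[of "\<one>\<^bsub>G\<^esub>" "\<one>\<^bsub>G\<^esub>" x] assms by simp
  then show ?thesis using R assms by simp
qed

lemma T_inv_T: "t \<in> carrier G \<Longrightarrow> x \<in> carrier E \<Longrightarrow> T (inv\<^bsub>G\<^esub> t) (T t x) = x"
  using T_mult[of "inv\<^bsub>G\<^esub> t" t x] by (simp add: T_one)

lemma T_T_inv: "t \<in> carrier G \<Longrightarrow> x \<in> carrier E \<Longrightarrow> T t (T (inv\<^bsub>G\<^esub> t) x) = x"
  using T_mult[of t "inv\<^bsub>G\<^esub> t" x] by (simp add: T_one)

lemma T_nonneg: "t \<in> carrier G \<Longrightarrow> x \<in> carrier E \<Longrightarrow> 0 \<sqsubseteq> x \<Longrightarrow> 0 \<sqsubseteq> T t x"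
  using positive_representation by (auto simp: positive_representation_def pos_cone_def)

lemma T_mono: "t \<in> carrier G \<Longrightarrow> x \<in> carrier E \<Longrightarrow> y \<in> carrier E \<Longrightarrow> x \<sqsubseteq> y \<Longrightarrow> T t x \<sqsubseteq> T t y"
  using T_nonneg[of t "y - x"] by (simp add: le_iff_diff_nonneg[symmetric] T_diff)

lemma T_eq_0_iff: "t \<in> carrier G \<Longrightarrow> x \<in> carrier E \<Longrightarrow> T t x = 0 \<longleftrightarrow> x = 0"
  by (metis T_inv_T T_scaleR G.inv_closed scaleR_zero_left zero_closed)

text \<open>The inverse of \<open>T t\<close> is again a positive operator of the action, so the
  interval below \<open>T t a\<close> is pulled back into the interval below
  \<open>a\<close>.\<close>

lemma minimal_positive_T:
  assumes t: "t \<in> carrier G" and a: "minimal_positive E a"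
  shows "minimal_positive E (T t a)"
proof -
  have aE: "a \<in> carrier E" "0 \<sqsubseteq> a" "a \<noteq> 0" using a by (auto simp: minimal_positive_def)
  have "\<exists>c. z = c *\<^sub>R T t a" if z: "z \<in> carrier E" "0 \<sqsubseteq> z" "z \<sqsubseteq> T t a" for z
  proof -
    have "T (inv\<^bsub>G\<^esub> t) z \<sqsubseteq> a"
      using T_mono[of "inv\<^bsub>G\<^esub> t" z "T t a"] z t aE by (simp add: T_inv_T)
    then obtain c where "T (inv\<^bsub>G\<^esub> t) z = c *\<^sub>R a"
      using minimal_positiveD[OF a, of "T (inv\<^bsub>G\<^esub> t) z"] z t T_nonneg by auto
    then have "z = T t (c *\<^sub>R a)" using T_T_inv z t by metis
    then show ?thesis using t aE by (auto simp: T_scaleR)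
  qed
  then show ?thesis using aE t by (auto simp: minimal_positive_def T_nonneg T_eq_0_iff)
qed

text \<open>Fixed vectors alone need not form an ideal. Requiring every positive vector below the
  modulus to be fixed makes the set solid from the outset.\<close>

definition "fixed_band =
  {x \<in> carrier E. \<forall>z\<in>carrier E. 0 \<sqsubseteq> z \<longrightarrow> z \<sqsubseteq> modulus E x \<longrightarrow> (\<forall>t\<in>carrier G. T t z = z)}"

lemma fixed_bandI:
  "x \<in> carrier E \<Longrightarrow>
   (\<And>z t. z \<in> carrier E \<Longrightarrow> 0 \<sqsubseteq> z \<Longrightarrow> z \<sqsubseteq> modulus E x \<Longrightarrow> t \<in> carrier G \<Longrightarrow> T t z = z)
   \<Longrightarrow> x \<in> fixed_band"
  by (auto simp: fixed_band_def)

lemma fixed_bandD: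
  "x \<in> fixed_band \<Longrightarrow> z \<in> carrier E \<Longrightarrow> 0 \<sqsubseteq> z \<Longrightarrow> z \<sqsubseteq> modulus E x \<Longrightarrow> t \<in> carrier G \<Longrightarrow> T t z = z"
  by (auto simp: fixed_band_def)

lemma fixed_band_carrier: "x \<in> fixed_band \<Longrightarrow> x \<in> carrier E"
  by (auto simp: fixed_band_def)

lemma fixed_band_ideal:
  assumes "y \<in> fixed_band" "x \<in> carrier E" "modulus E x \<sqsubseteq> modulus E y"
  shows "x \<in> fixed_band"
proof (rule fixed_bandI)
  fix z t assume z: "z \<in> carrier E" "0 \<sqsubseteq> z" "z \<sqsubseteq> modulus E x" "t \<in> carrier G"
  have "z \<sqsubseteq> modulus E y"
    using z assms fixed_band_carrier[of y] by - (rule le_trans[of z "modulus E x"], simp_all)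
  then show "T t z = z" using z assms by (auto intro: fixed_bandD)
qed fact

lemma T_eq_of_le_modulus_add:
  assumes "x \<in> carrier E" "0 \<sqsubseteq> x" "y \<in> carrier E" "0 \<sqsubseteq> y" "t \<in> carrier G"
    and "z \<in> carrier E" "0 \<sqsubseteq> z" "z \<sqsubseteq> x + y"
    and "\<And>u. u \<in> carrier E \<Longrightarrow> 0 \<sqsubseteq> u \<Longrightarrow> u \<sqsubseteq> x \<Longrightarrow> T t u = u"
    and "\<And>u. u \<in> carrier E \<Longrightarrow> 0 \<sqsubseteq> u \<Longrightarrow> u \<sqsubseteq> y \<Longrightarrow> T t u = u"
  shows "T t z = z"
  using assms by (elim riesz_decomposition[of x y z, rotated 6]) (simp_all add: T_add)

lemma subspace_fixed_band: "subspace fixed_band"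
proof (rule subspaceI)
  show "0 \<in> fixed_band"
  proof (rule fixed_bandI)
    fix z t assume "z \<in> carrier E" "0 \<sqsubseteq> z" "z \<sqsubseteq> modulus E 0" "t \<in> carrier G"
    then have "z = 0" using modulus_of_nonneg[of 0] antisym_eq[of z 0] by simp
    then show "T t z = z" using T_eq_0_iff[of t z] \<open>t \<in> carrier G\<close> by simp
  qed simp
next
  fix x y assume xy: "x \<in> fixed_band" "y \<in> fixed_band"
  then have E: "x \<in> carrier E" "y \<in> carrier E" by (auto intro: fixed_band_carrier)
  show "x + y \<in> fixed_band"
  proof (rule fixed_bandI)
    fix z t assume z: "z \<in> carrier E" "0 \<sqsubseteq> z" "z \<sqsubseteq> modulus E (x + y)" "t \<in> carrier G"
    have "z \<sqsubseteq> modulus E x + modulus E y"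
      using z E modulus_add_le by - (rule le_trans[of z "modulus E (x + y)"], simp_all)
    then show "T t z = z"
      using z E by - (rule T_eq_of_le_modulus_add[of "modulus E x" "modulus E y"],
        simp_all add: modulus_nonneg fixed_bandD[OF xy(1)] fixed_bandD[OF xy(2)])
  qed (use E in simp)
next
  fix c x assume x: "x \<in> fixed_band"
  then have E: "x \<in> carrier E" by (rule fixed_band_carrier)
  show "c *\<^sub>R x \<in> fixed_band"
  proof (rule fixed_bandI)
    fix z t assume z: "z \<in> carrier E" "0 \<sqsubseteq> z" "z \<sqsubseteq> modulus E (c *\<^sub>R x)" "t \<in> carrier G"
    \<comment> \<open>The summand 1 makes \<open>d\<close> invertible also when \<open>c\<close> is
      0.\<close>
    define d where "d = \<bar>c\<bar> + 1"
    have d: "d > 0" by (simp add: d_def)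
    have "z \<sqsubseteq> \<bar>c\<bar> *\<^sub>R modulus E x"
      using z E modulus_scaleR_le by - (rule le_trans[of z "modulus E (c *\<^sub>R x)"], simp_all)
    moreover have "\<bar>c\<bar> *\<^sub>R modulus E x \<sqsubseteq> d *\<^sub>R modulus E x"
      using E by (intro scaleR_mono_left modulus_nonneg) (auto simp: d_def)
    ultimately have "z \<sqsubseteq> d *\<^sub>R modulus E x"
      using z E by - (rule le_trans[of z "\<bar>c\<bar> *\<^sub>R modulus E x"], simp_all)
    then have "inverse d *\<^sub>R z \<sqsubseteq> modulus E x"
      using scaleR_le_iff[of "inverse d *\<^sub>R z" "modulus E x" d] z E d by simp
    then have "T t (inverse d *\<^sub>R z) = inverse d *\<^sub>R z"
      using z E d x by (intro fixed_bandD[of x]) (auto intro!: scaleR_nonneg)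
    then show "T t z = z" using z d by (simp add: T_scaleR)
  qed (use E in simp)
qed

lemma order_ideal_fixed_band: "order_ideal E fixed_band"
  unfolding order_ideal_def
  using subspace_fixed_band fixed_band_ideal fixed_band_carrier by blast

text \<open>For each \<open>a\<close> in \<open>A\<close>, the meet of \<open>z\<close> with the
  positive part of \<open>a - a0\<close> is fixed, hence below \<open>T t z\<close>. This shows that
  \<open>s + T t z - z\<close> is still an upper bound of \<open>A\<close>, and leastness of
  \<open>s\<close> gives the claim without an infinite distributive law.\<close>

lemma least_le_invariant:
  assumes A: "A \<subseteq> fixed_band" "a0 \<in> A" and s: "least E s (Upper E A)"
    and z: "z \<in> carrier E" "0 \<sqsubseteq> z" "z \<sqsubseteq> s - a0" and t: "t \<in> carrier G"
  shows "z \<sqsubseteq> T t z"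
proof -
  have AE: "A \<subseteq> carrier E" using A fixed_band_carrier by auto
  have sE: "s \<in> carrier E" using s by (rule least_closed)
  have s_upper: "a \<sqsubseteq> s" if "a \<in> A" for a using least_Upper_above[OF s that AE] .
  have a0E: "a0 \<in> carrier E" using A AE by auto
  have "s + T t z - z \<in> Upper E A"
  proof (rule Upper_memI)
    fix a assume "a \<in> A"
    then have aE: "a \<in> carrier E" using AE by auto
    define p where "p = (a - a0) \<squnion> 0"
    have "a - a0 \<sqsubseteq> s - a0" "0 \<sqsubseteq> s - a0"
      using aE a0E sE s_upper[OF \<open>a \<in> A\<close>] s_upper[OF A(2)] by (simp_all add: le_diff_iff)
    then have p: "p \<in> carrier E" "0 \<sqsubseteq> p" "a - a0 \<sqsubseteq> p" "p \<sqsubseteq> s - a0"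
      using aE a0E sE by (auto simp: p_def intro: join_right join_left join_le)
    have "p \<sqsubseteq> modulus E (a - a0)"
      unfolding p_def using aE a0E by (intro join_le le_modulus modulus_nonneg) auto
    have m: "z \<sqinter> p \<in> carrier E" "0 \<sqsubseteq> z \<sqinter> p" "z \<sqinter> p \<sqsubseteq> z"
      using z p by (auto intro: meet_le meet_left)
    have "z \<sqinter> p \<sqsubseteq> modulus E (a - a0)"
      using z p aE a0E \<open>p \<sqsubseteq> modulus E (a - a0)\<close> meet_right[of z p]
      by - (rule le_trans[of "z \<sqinter> p" p], simp_all)
    moreover have "a - a0 \<in> fixed_band"
      using subspace_fixed_band \<open>a \<in> A\<close> A by (auto intro: subspace_diff)
    ultimately have "T t (z \<sqinter> p) = z \<sqinter> p"
      using m t by (intro fixed_bandD[of "a - a0"])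
    then have le: "z \<sqinter> p \<sqsubseteq> T t z"
      using T_mono[of t "z \<sqinter> p" z] m z t by simp
    \<comment> \<open>Both \<open>z\<close> and \<open>p\<close> lie below
      \<open>s - a0\<close>.\<close>
    have "z + p - (s - a0) \<sqsubseteq> z \<sqinter> p"
      using z p sE a0E by (intro add_diff_le_meet) auto
    then have "z + p - (s - a0) \<sqsubseteq> T t z"
      using le z p sE a0E t by - (rule le_trans[of _ "z \<sqinter> p"], simp_all)
    then have "p \<sqsubseteq> s + T t z - z - a0"
      using z p sE a0E t by (simp add: diff_le_iff le_diff_iff algebra_simps)
    then have "a - a0 \<sqsubseteq> s + T t z - z - a0"
      using p aE a0E sE z t by - (rule le_trans[of _ p], simp_all)
    then show "a \<sqsubseteq> s + T t z - z"
      using aE a0E sE z t by (simp add: diff_le_iff)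
  qed (use sE z t in simp)
  then have "s \<sqsubseteq> s + T t z - z"
    using s by (simp add: least_def)
  then show ?thesis
    using sE z t by (subst le_iff_diff_nonneg) (simp_all add: le_iff_diff_nonneg[of s])
qed

text \<open>The inequality of \<open>least_le_invariant\<close>, used for \<open>t\<close> and for
  its inverse, makes everything between 0 and \<open>s - a0\<close> fixed. The modulus of
  \<open>s\<close> is at most \<open>s - a0\<close> plus the modulus of \<open>a0\<close>, so Riesz
  decomposition finishes.\<close>

lemma band_fixed_band: "band E fixed_band"
  unfolding band_def
proof (intro conjI allI impI order_ideal_fixed_band)
  fix A s assume A: "A \<subseteq> fixed_band" and s: "least E s (Upper E A)"
  have sE: "s \<in> carrier E" using s by (rule least_closed)
  have AE: "A \<subseteq> carrier E" using A fixed_band_carrier by auto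
  show "s \<in> fixed_band"
  proof (cases "A = {}")
    case True
    \<comment> \<open>Every vector bounds the empty set, so \<open>s\<close> would be the least
      element of \<open>E\<close>, which forces \<open>s = 0\<close>.\<close>
    then have le: "s \<sqsubseteq> x" if "x \<in> carrier E" for x using s that by (simp add: least_def)
    have "s \<sqsubseteq> 0" "s \<sqsubseteq> s + s" using le sE by auto
    moreover from this have "0 \<sqsubseteq> s" using le_iff_diff_nonneg[of s "s + s"] sE by simp
    ultimately have "s = 0" using sE by (intro antisym_eq) auto
    then show ?thesis using subspace_fixed_band subspace_0 by simp
  next
    case False
    then obtain a0 where a0: "a0 \<in> A" by auto
    then have a0E: "a0 \<in> carrier E" using AE by auto
    have s_upper: "a0 \<sqsubseteq> s" using least_Upper_above[OF s a0 AE] .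
    have invariant: "T t z = z"
      if z: "z \<in> carrier E" "0 \<sqsubseteq> z" "z \<sqsubseteq> s - a0" and t: "t \<in> carrier G" for z t
    proof (rule antisym_eq)
      show "z \<sqsubseteq> T t z" using least_le_invariant[OF A a0 s z t] .
      have "z \<sqsubseteq> T (inv\<^bsub>G\<^esub> t) z" using least_le_invariant[OF A a0 s z] t by simp
      then show "T t z \<sqsubseteq> z" using T_mono[of t z "T (inv\<^bsub>G\<^esub> t) z"] z t by (simp add: T_T_inv)
    qed (use z t in auto)
    show ?thesis
    proof (rule fixed_bandI[OF sE])
      fix z t assume z: "z \<in> carrier E" "0 \<sqsubseteq> z" "z \<sqsubseteq> modulus E s" and t: "t \<in> carrier G"
      have nonneg: "0 \<sqsubseteq> s - a0" using s_upper sE a0E le_iff_diff_nonneg[of a0 s] by simp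
      have "modulus E s \<sqsubseteq> (s - a0) + modulus E a0"
        using modulus_add_le[of "s - a0" a0] sE a0E nonneg by (simp add: modulus_of_nonneg)
      then have "z \<sqsubseteq> (s - a0) + modulus E a0"
        using z sE a0E by - (rule le_trans[of z "modulus E s"], simp_all)
      then show "T t z = z"
      proof (rule T_eq_of_le_modulus_add[rotated 7])
        show "T t u = u" if "u \<in> carrier E" "0 \<sqsubseteq> u" "u \<sqsubseteq> s - a0" for u
          using invariant that t by blast
        show "T t u = u" if "u \<in> carrier E" "0 \<sqsubseteq> u" "u \<sqsubseteq> modulus E a0" for u
          using fixed_bandD[of a0 u t] that t A a0 by auto
      qed (use z t sE a0E nonneg modulus_nonneg in auto)
    qed
  qed
qed

text \<open>Every \<open>x\<close> is the difference of the positive vectors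
  \<open>x + modulus E x\<close> and \<open>modulus E x\<close>.\<close>

lemma T_eq_of_fixed_band:
  assumes "fixed_band = carrier E" "x \<in> carrier E" "t \<in> carrier G"
  shows "T t x = x"
proof -
  have "T t z = z" if "z \<in> carrier E" "0 \<sqsubseteq> z" for z
    using that assms by (intro fixed_bandD[of z]) (auto simp: le_modulus)
  then have "T t (x + modulus E x) = x + modulus E x" "T t (modulus E x) = modulus E x"
    using assms add_mono[of "- x" "modulus E x" x x] 
    by (auto simp: modulus_nonneg uminus_le_modulus add.commute)
  then show ?thesis using T_add[of t x "modulus E x"] assms by simp
qed

end

subsection \<open>Orbits of atoms\<close>

context banach_lattice
begin

lemma nrm_le_operator_norm:
  assumes S: "bounded_operator E S" and x: "x \<in> carrier E"
  shows "nrm E (S x) \<le> operator_norm E S * nrm E x"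
proof (cases "x = 0")
  case True
  have "S (0 *\<^sub>R x) = 0 *\<^sub>R S x" using S x unfolding bounded_operator_def by blast
  then show ?thesis using True nrm_eq_0_iff[of 0] by simp
next
  case False
  then have pos: "nrm E x > 0" using x nrm_pos by simp
  obtain K where K: "\<forall>z\<in>carrier E. nrm E (S z) \<le> K * nrm E z"
    using S unfolding bounded_operator_def by blast
  have "bdd_above ((\<lambda>z. nrm E (S z)) ` {z \<in> carrier E. nrm E z \<le> 1})"
  proof (rule bdd_aboveI2)
    fix z assume "z \<in> {z \<in> carrier E. nrm E z \<le> 1}"
    then have z: "z \<in> carrier E" "nrm E z \<le> 1" by auto
    have "nrm E (S z) \<le> K * nrm E z" using K z by simp
    \<comment> \<open>The absolute value is taken because the sign of \<open>K\<close> is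
      unknown.\<close>
    also have "\<dots> \<le> \<bar>K\<bar> * 1" using z nrm_nonneg[of z] by (intro mult_mono) auto
    finally show "nrm E (S z) \<le> \<bar>K\<bar>" by simp
  qed
  then have "nrm E (S (inverse (nrm E x) *\<^sub>R x)) \<le> operator_norm E S"
    unfolding operator_norm_def using x pos by (intro cSUP_upper) (auto simp: nrm_scaleR)
  moreover have "S (inverse (nrm E x) *\<^sub>R x) = inverse (nrm E x) *\<^sub>R S x" "S x \<in> carrier E"
    using S x unfolding bounded_operator_def by blast+
  ultimately show ?thesis
    using pos by (simp add: nrm_scaleR field_simps)
qed

text \<open>The differences \<open>u - \<Sum>F\<close>, where \<open>u\<close> bounds all finite sums over \<open>A\<close>, form a net decreasing
  to \<open>0\<close>; this needs no suprema in \<open>E\<close>.\<close>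

lemma order_continuous_norm_imp_finite:
  assumes oc: "order_continuous_norm E" and A: "A \<subseteq> carrier E" "\<And>b. b \<in> A \<Longrightarrow> 0 \<sqsubseteq> b"
    and y: "y \<in> carrier E" "\<And>F. finite F \<Longrightarrow> F \<subseteq> A \<Longrightarrow> \<Sum>F \<sqsubseteq> y"
    and \<delta>: "\<delta> > 0" "\<And>b. b \<in> A \<Longrightarrow> \<delta> \<le> nrm E b"
  shows "finite A"
proof -
  define U where "U = {u \<in> carrier E. \<forall>F. finite F \<longrightarrow> F \<subseteq> A \<longrightarrow> \<Sum>F \<sqsubseteq> u}"
  define D where "D = {u - \<Sum>F | u F. u \<in> U \<and> finite F \<and> F \<subseteq> A}"
  have sumE: "\<Sum>F \<in> carrier E" if "F \<subseteq> A" for F using that A by (intro sum_closed) auto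
  have yU: "y \<in> U" using y by (auto simp: U_def)
  have UE: "u \<in> carrier E" if "u \<in> U" for u using that by (simp add: U_def)
  have U_le: "\<Sum>F \<sqsubseteq> u" if "u \<in> U" "finite F" "F \<subseteq> A" for u F using that by (simp add: U_def)
  have DI: "u - \<Sum>F \<in> D" if "u \<in> U" "finite F" "F \<subseteq> A" for u F using that by (auto simp: D_def)
  have DE: "D \<subseteq> carrier E" using UE sumE by (auto simp: D_def)
  have directed: "\<exists>z\<in>D. z \<sqsubseteq> x \<and> z \<sqsubseteq> x'" if "x \<in> D" "x' \<in> D" for x x'
  proof -
    from that obtain u F u' F' where *: "x = u - \<Sum>F" "x' = u' - \<Sum>F'" "u \<in> U" "u' \<in> U"
      "finite F" "F \<subseteq> A" "finite F'" "F' \<subseteq> A" by (auto simp: D_def)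
    define v where "v = u \<sqinter> u'"
    have v: "v \<in> carrier E" "v \<sqsubseteq> u" "v \<sqsubseteq> u'"
      using * UE by (auto simp: v_def intro: meet_left meet_right)
    have "\<Sum>H \<sqsubseteq> v" if "finite H" "H \<subseteq> A" for H
      unfolding v_def using that * UE U_le sumE by - (rule meet_le, simp_all)
    then have "v \<in> U" using v by (simp add: U_def)
    \<comment> \<open>The right side exceeds the left by
      \<open>(w - v) + \<Sum>(F \<union> F' - H)\<close>, a sum of positive terms.\<close>
    have mono: "v - \<Sum>(F \<union> F') \<sqsubseteq> w - \<Sum>H"
      if "w \<in> carrier E" "v \<sqsubseteq> w" "H \<subseteq> F \<union> F'" for w H
    proof -
      have "\<Sum>(F \<union> F') = \<Sum>(F \<union> F' - H) + \<Sum>H"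
        using * that by (intro sum.subset_diff) auto
      moreover have "F \<union> F' - H \<subseteq> A" using * by auto
      moreover have "0 \<sqsubseteq> \<Sum>(F \<union> F' - H)"
        using * A by (intro sum_nonneg) auto
      moreover have "H \<subseteq> A" using that * by auto
      ultimately show ?thesis
        using that v sumE[of H] sumE[of "F \<union> F' - H"] add_mono[of v w 0 "\<Sum>(F \<union> F' - H)"]
        by (simp add: diff_le_iff)
    qed
    have "v - \<Sum>(F \<union> F') \<in> D" using * \<open>v \<in> U\<close> by (intro DI) auto
    moreover have "v - \<Sum>(F \<union> F') \<sqsubseteq> x" "v - \<Sum>(F \<union> F') \<sqsubseteq> x'"
      using mono[of u F] mono[of u' F'] * v UE by auto
    ultimately show ?thesis by blast
  qed
  have inf: "greatest E 0 (Lower E D)"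
    unfolding greatest_def
  proof (intro conjI ballI)
    show "0 \<in> Lower E D"
    proof (rule Lower_memI)
      fix d assume "d \<in> D"
      then obtain u F where "d = u - \<Sum>F" "u \<in> U" "finite F" "F \<subseteq> A" by (auto simp: D_def)
      then show "0 \<sqsubseteq> d" using U_le[of u F] UE[of u] sumE[of F] le_iff_diff_nonneg[of "\<Sum>F" u] by simp
    qed simp
    fix w assume w: "w \<in> Lower E D"
    then have wE: "w \<in> carrier E" by (auto simp: Lower_def)
    define p where "p = w \<squnion> 0"
    have p: "p \<in> carrier E" "0 \<sqsubseteq> p" "w \<sqsubseteq> p"
      using wE by (auto simp: p_def intro: join_left join_right)
    have p_le: "p \<sqsubseteq> d" if "d \<in> D" for d
      using Lower_memD[OF w that DE] Lower_memD[OF \<open>0 \<in> Lower E D\<close> that DE] that DE wE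
      by (auto simp: p_def intro: join_le)
    \<comment> \<open>Since \<open>p\<close> is below every \<open>u - \<Sum>F\<close>, subtracting
      \<open>p\<close> does not lead out of \<open>U\<close>. Iterating from \<open>y\<close> and
      taking the empty sum bounds all multiples of \<open>p\<close> by \<open>y\<close>.\<close>
    have "y - real n *\<^sub>R p \<in> U" for n
    proof (induction n)
      case (Suc n)
      have "\<Sum>F \<sqsubseteq> y - real n *\<^sub>R p - p" if "finite F" "F \<subseteq> A" for F
        using p_le[OF DI[OF Suc that]] p y sumE that by (simp add: le_diff_iff add.commute)
      then show ?case using p y by (simp add: U_def algebra_simps)
    qed (use yU in simp)
    then have "0 \<sqsubseteq> y - real n *\<^sub>R p" for n using U_le[of "y - real n *\<^sub>R p" "{}"] by simp
    then have "real n *\<^sub>R p \<sqsubseteq> y" for n using le_iff_diff_nonneg[of "real n *\<^sub>R p" y] p y by simp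
    then have "p = 0" using p y by (intro archimedean[of p y]) blast+
    then show "w \<sqsubseteq> 0" using p by simp
  qed (auto simp: Lower_def)
  have "D \<noteq> {}" using DI[OF yU, of "{}"] by auto
  then obtain d where "d \<in> D" and d: "\<forall>x\<in>D. x \<sqsubseteq> d \<longrightarrow> nrm E x < \<delta>"
    using oc[unfolded order_continuous_norm_def, THEN spec, THEN mp, OF DE, THEN mp,
        OF \<open>D \<noteq> {}\<close>, rule_format, OF directed inf] \<delta>(1) by blast
  then obtain u F where uF: "d = u - \<Sum>F" "u \<in> U" "finite F" "F \<subseteq> A" by (auto simp: D_def)
  have "nrm E d < \<delta>" using d \<open>d \<in> D\<close> DE le_refl by blast
  \<comment> \<open>An element of \<open>A\<close> outside \<open>F\<close> could be added to the
    sum, so it would lie below \<open>d\<close> and have norm less than \<delta>.\<close>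
  have "A \<subseteq> F"
  proof
    fix b assume "b \<in> A"
    show "b \<in> F"
    proof (rule ccontr)
      assume "b \<notin> F"
      then have "b + \<Sum>F \<sqsubseteq> u" using U_le[of u "insert b F"] uF \<open>b \<in> A\<close> by simp
      moreover have "b \<in> carrier E" "u \<in> carrier E" "\<Sum>F \<in> carrier E"
        using uF UE sumE A \<open>b \<in> A\<close> by auto
      ultimately have "b \<sqsubseteq> d" using le_diff_iff[of b "\<Sum>F" u] uF(1) by simp
      then have "nrm E b \<le> nrm E d"
        using A \<open>b \<in> A\<close> \<open>d \<in> D\<close> DE by (intro nrm_mono_nonneg) auto
      then show False using \<delta>(2)[OF \<open>b \<in> A\<close>] \<open>nrm E d < \<delta>\<close> by simp
    qed
  qed
  then show ?thesis using uF finite_subset by blast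
qed

end

context positive_action
begin

text \<open>Iterating \<open>T t\<close>, which fixes \<open>y\<close>, keeps every
  \<open>c ^ n *\<^sub>R b\<close> below \<open>y\<close>; for \<open>c\<close> above 1 this
  contradicts the Archimedean property.\<close>

lemma eigenvalue_le_1:
  assumes t: "t \<in> carrier G" and b: "b \<in> carrier E" "0 \<sqsubseteq> b" "b \<noteq> 0" "b \<sqsubseteq> y"
    and y: "y \<in> carrier E" "\<And>t. t \<in> carrier G \<Longrightarrow> T t y = y" and c: "T t b = c *\<^sub>R b"
  shows "c \<le> 1"
proof (rule ccontr)
  assume "\<not> c \<le> 1"
  have le: "c ^ n *\<^sub>R b \<sqsubseteq> y" for n
  proof (induction n)
    case (Suc n)
    have "T t (c ^ n *\<^sub>R b) \<sqsubseteq> T t y" using Suc t b y by (intro T_mono) auto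
    then show ?case using t b y c by (simp add: T_scaleR mult.commute)
  qed (use b in simp)
  have "\<exists>d\<ge>real n. d *\<^sub>R b \<sqsubseteq> y" for n
    using le real_arch_pow[of c "real n"] \<open>\<not> c \<le> 1\<close> by (meson less_imp_le not_le)
  then show False using archimedean[of b y] b y by blast
qed

text \<open>The bound applies to \<open>t\<close> and to its inverse, whose eigenvalue is
  \<open>inverse c\<close>.\<close>

lemma eigenvalue_eq_1:
  assumes t: "t \<in> carrier G" and b: "b \<in> carrier E" "0 \<sqsubseteq> b" "b \<noteq> 0" "b \<sqsubseteq> y"
    and y: "y \<in> carrier E" "\<And>t. t \<in> carrier G \<Longrightarrow> T t y = y" and c: "T t b = c *\<^sub>R b"
  shows "c = 1"
proof -
  have "c \<ge> 0" using scaleR_nonneg_imp[of b c] T_nonneg[OF t, of b] b c by simp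
  moreover have "c \<noteq> 0" using T_eq_0_iff[OF t, of b] b c by auto
  ultimately have "c > 0" by simp
  have "b = c *\<^sub>R T (inv\<^bsub>G\<^esub> t) b" using T_inv_T[OF t, of b] t b c by (simp add: T_scaleR)
  then have "inverse c *\<^sub>R b = inverse c *\<^sub>R c *\<^sub>R T (inv\<^bsub>G\<^esub> t) b" by (rule arg_cong)
  then have "T (inv\<^bsub>G\<^esub> t) b = inverse c *\<^sub>R b" using \<open>c > 0\<close> by simp
  then have "inverse c \<le> 1" using t b y by (intro eigenvalue_le_1[of "inv\<^bsub>G\<^esub> t" b y]) auto
  moreover have "c \<le> 1" using t b y c by (intro eigenvalue_le_1[of t b y]) auto
  ultimately show ?thesis using \<open>c > 0\<close> by (simp add: inverse_le_1_iff)
qed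

text \<open>A nonzero meet is a multiple of both minimal elements, so these are proportional. Some
  group element carries one to the other, and its eigenvalue must be 1.\<close>

lemma orbit_disjoint:
  assumes a: "minimal_positive E a" "a \<sqsubseteq> y"
    and y: "y \<in> carrier E" "\<And>t. t \<in> carrier G \<Longrightarrow> T t y = y"
    and ts: "t \<in> carrier G" "s \<in> carrier G" "T t a \<noteq> T s a"
  shows "T t a \<sqinter> T s a = 0"
proof (rule ccontr)
  define b b' where "b = T t a" and "b' = T s a"
  have aE: "a \<in> carrier E" using a by (simp add: minimal_positive_def)
  have b: "minimal_positive E b" "minimal_positive E b'"
    using a ts by (auto simp: b_def b'_def intro: minimal_positive_T)
  then have bE: "b \<in> carrier E" "0 \<sqsubseteq> b" "b \<noteq> 0" "b' \<in> carrier E" "0 \<sqsubseteq> b'"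
    by (auto simp: minimal_positive_def)
  have "b \<sqsubseteq> y" using T_mono[of t a y] a y ts aE by (simp add: b_def)
  assume "T t a \<sqinter> T s a \<noteq> 0"
  then have "b \<sqinter> b' \<noteq> 0" by (simp add: b_def b'_def)
  moreover have m: "b \<sqinter> b' \<in> carrier E" "0 \<sqsubseteq> b \<sqinter> b'" "b \<sqinter> b' \<sqsubseteq> b" "b \<sqinter> b' \<sqsubseteq> b'"
    using bE by (auto intro: meet_le meet_left meet_right)
  moreover obtain c where "b \<sqinter> b' = c *\<^sub>R b" using minimal_positiveD[OF b(1) m(1,2,3)] .
  moreover obtain d where "b \<sqinter> b' = d *\<^sub>R b'" using minimal_positiveD[OF b(2) m(1,2,4)] .
  ultimately have "c *\<^sub>R b = d *\<^sub>R b'" "d \<noteq> 0" by auto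
  then have "inverse d *\<^sub>R c *\<^sub>R b = b'" by simp
  then have b': "b' = (inverse d * c) *\<^sub>R b" by simp
  define r where "r = s \<otimes>\<^bsub>G\<^esub> inv\<^bsub>G\<^esub> t"
  have r: "r \<in> carrier G" "T r b = b'"
    using ts aE by (auto simp: r_def b_def b'_def T_mult T_inv_T)
  then have "inverse d * c = 1"
    using b' bE y \<open>b \<sqsubseteq> y\<close> by (intro eigenvalue_eq_1[of r b y]) auto
  then show False using b' ts by (simp add: b_def b'_def)
qed

text \<open>Distinct orbit elements are disjoint and below \<open>y\<close>, so their finite sums
  stay below \<open>y\<close>. Applying the uniform operator bound to inverses keeps their norms
  away from 0.\<close>

lemma finite_orbit:
  assumes bounded: "bounded_representation G E T" and oc: "order_continuous_norm E"
    and a: "minimal_positive E a" "a \<sqsubseteq> y"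
    and y: "y \<in> carrier E" "\<And>t. t \<in> carrier G \<Longrightarrow> T t y = y"
  shows "finite ((\<lambda>t. T t a) ` carrier G)"
proof -
  have aE: "a \<in> carrier E" "0 \<sqsubseteq> a" "a \<noteq> 0" using a by (auto simp: minimal_positive_def)
  have yE: "0 \<sqsubseteq> y" using a(2) aE y le_trans[of 0 a y] by simp
  obtain M where M: "operator_norm E (T t) \<le> M" if "t \<in> carrier G" for t
    using bounded by (auto simp: bounded_representation_def bdd_above_def)
  \<comment> \<open>The maximum with 1 keeps the divisor positive.\<close>
  define K where "K = max M 1"
  have K: "K > 0" by (simp add: K_def)
  have lower: "nrm E a / K \<le> nrm E (T t a)" if t: "t \<in> carrier G" for t
  proof -
    have "nrm E (T (inv\<^bsub>G\<^esub> t) (T t a)) \<le> operator_norm E (T (inv\<^bsub>G\<^esub> t)) * nrm E (T t a)"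
      using t aE by (intro nrm_le_operator_norm bounded_operator) auto
    also have "\<dots> \<le> K * nrm E (T t a)"
      using M[of "inv\<^bsub>G\<^esub> t"] t aE by (intro mult_right_mono nrm_nonneg) (auto simp: K_def)
    finally show ?thesis using K t aE by (simp add: T_inv_T field_simps)
  qed
  have le_y: "T t a \<sqsubseteq> y" if "t \<in> carrier G" for t using T_mono[of t a y] that a y aE by simp
  show ?thesis
  proof (rule order_continuous_norm_imp_finite[OF oc _ _ y(1)])
    show "nrm E a / K > 0" using nrm_pos[of a] aE K by simp
    fix F assume F: "finite F" "F \<subseteq> (\<lambda>t. T t a) ` carrier G"
    have "b \<in> carrier E \<and> 0 \<sqsubseteq> b \<and> b \<sqsubseteq> y" if "b \<in> F" for b
    proof -
      obtain t where "t \<in> carrier G" "b = T t a" using F(2) \<open>b \<in> F\<close> by blast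
      then show ?thesis using aE le_y T_nonneg[of t a] by simp
    qed
    moreover have "b \<sqinter> b' = 0" if bb': "b \<in> F" "b' \<in> F" "b \<noteq> b'" for b b'
    proof -
      obtain t where t: "t \<in> carrier G" "b = T t a" using F(2) bb'(1) by blast
      obtain s where s: "s \<in> carrier G" "b' = T s a" using F(2) bb'(2) by blast
      have "T t a \<noteq> T s a" using t s bb'(3) by simp
      then show ?thesis unfolding t s using y(2) by (intro orbit_disjoint[OF a y(1) _ t(1) s(1)]) simp_all
    qed
    ultimately show "\<Sum>F \<sqsubseteq> y"
      using F(1) y(1) yE by (intro sum_le_of_pairwise_disjoint) (simp_all add: subset_eq)
    qed (use aE lower T_nonneg in auto)
qed

text \<open>\<open>N\<close> is the kernel of the action on the whole orbit of \<open>a\<close>; the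
  stabiliser of \<open>a\<close> alone need not be normal. Conjugates stay in \<open>N\<close>
  because the group maps the orbit to itself.\<close>

lemma orbit_kernel_normal:
  assumes a: "a \<in> carrier E"
  defines "N \<equiv> {t \<in> carrier G. \<forall>s\<in>carrier G. T t (T s a) = T s a}"
  shows "N \<lhd> G"
proof (rule G.normal_invI)
  have inv: "T (inv\<^bsub>G\<^esub> t) (T s a) = T s a" if "t \<in> N" "s \<in> carrier G" for t s
    using that a T_inv_T[of t "T s a"] by (auto simp: N_def)
  show "subgroup N G"
    by (rule G.subgroupI) (use a inv in \<open>auto simp: N_def T_mult T_one intro!: exI[of _ "\<one>\<^bsub>G\<^esub>"]\<close>)
  fix x h assume x: "x \<in> carrier G" and "h \<in> N"
  then have h: "h \<in> carrier G" by (simp add: N_def)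
  have "T (x \<otimes>\<^bsub>G\<^esub> h \<otimes>\<^bsub>G\<^esub> inv\<^bsub>G\<^esub> x) (T s a) = T s a" if s: "s \<in> carrier G" for s
  proof -
    have "T h (T (inv\<^bsub>G\<^esub> x \<otimes>\<^bsub>G\<^esub> s) a) = T (inv\<^bsub>G\<^esub> x \<otimes>\<^bsub>G\<^esub> s) a"
      using \<open>h \<in> N\<close> x s by (simp add: N_def)
    then show ?thesis using x h s a by (simp add: T_mult T_T_inv)
  qed
  then show "x \<otimes>\<^bsub>G\<^esub> h \<otimes>\<^bsub>G\<^esub> inv\<^bsub>G\<^esub> x \<in> N" using x h by (simp add: N_def)
qed

text \<open>The self-map of the orbit induced by \<open>t\<close> determines the coset of
  \<open>t\<close>, and a finite orbit has only finitely many self-maps.\<close>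

lemma orbit_kernel_finite_index:
  assumes a: "a \<in> carrier E" and fin: "finite ((\<lambda>t. T t a) ` carrier G)"
  defines "N \<equiv> {t \<in> carrier G. \<forall>s\<in>carrier G. T t (T s a) = T s a}"
  shows "finite (carrier (G Mod N))"
proof -
  define A where "A = (\<lambda>t. T t a) ` carrier G"
  interpret N: normal N G unfolding N_def using a by (rule orbit_kernel_normal)
  \<comment> \<open>Restriction discards the values off the orbit, so that \<open>f\<close> takes
    values in a finite function space.\<close>
  define f where "f t = restrict (T t) A" for t
  have "f ` carrier G \<subseteq> A \<rightarrow>\<^sub>E A"
  proof (clarsimp simp: f_def)
    fix t b assume "t \<in> carrier G" "b \<in> A"
    then show "T t b \<in> A"
      using a by (auto simp: A_def T_mult[symmetric] intro!: imageI)
  qed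
  then have finf: "finite (f ` carrier G)"
    using fin finite_PiE[of A "\<lambda>_. A"] finite_subset by (auto simp: A_def)
  have coset: "N #>\<^bsub>G\<^esub> t = N #>\<^bsub>G\<^esub> s" if ts: "t \<in> carrier G" "s \<in> carrier G" "f t = f s" for t s
  proof -
    have eq: "T t (T r a) = T s (T r a)" if "r \<in> carrier G" for r
      using fun_cong[OF ts(3), of "T r a"] that by (auto simp: f_def A_def)
    have "T (t \<otimes>\<^bsub>G\<^esub> inv\<^bsub>G\<^esub> s) (T r a) = T r a" if r: "r \<in> carrier G" for r
      using eq[of "inv\<^bsub>G\<^esub> s \<otimes>\<^bsub>G\<^esub> r"] ts r a by (simp add: T_mult T_T_inv)
    moreover have "t \<otimes>\<^bsub>G\<^esub> inv\<^bsub>G\<^esub> s \<in> carrier G" using ts by simp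
    ultimately have "t \<otimes>\<^bsub>G\<^esub> inv\<^bsub>G\<^esub> s \<in> N"
      unfolding N_def by blast
    then have "t \<in> N #>\<^bsub>G\<^esub> s" using ts N.rcos_module[OF G.is_group] by simp
    then show ?thesis using G.repr_independence[OF _ ts(2) N.subgroup_axioms] by simp
  qed
  define g where "g h = N #>\<^bsub>G\<^esub> inv_into (carrier G) f h" for h
  have "N #>\<^bsub>G\<^esub> t = g (f t)" if "t \<in> carrier G" for t
    unfolding g_def using that inv_into_into[of "f t" f "carrier G"] f_inv_into_f[of "f t" f "carrier G"]
    by (intro coset) simp_all
  then have "carrier (G Mod N) \<subseteq> g ` f ` carrier G" by (auto simp: carrier_FactGroup)
  then show ?thesis using finf finite_surj by blast
qed

lemma atom_fixed:
  assumes G: "\<And>N. N \<lhd> G \<Longrightarrow> N \<noteq> carrier G \<Longrightarrow> infinite (carrier (G Mod N))"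
    and bounded: "bounded_representation G E T" and oc: "order_continuous_norm E"
    and a: "minimal_positive E a" "a \<sqsubseteq> y"
    and y: "y \<in> carrier E" "\<And>t. t \<in> carrier G \<Longrightarrow> T t y = y"
    and t: "t \<in> carrier G"
  shows "T t a = a"
proof -
  have aE: "a \<in> carrier E" using a by (simp add: minimal_positive_def)
  have "{t \<in> carrier G. \<forall>s\<in>carrier G. T t (T s a) = T s a} = carrier G"
    using G[OF orbit_kernel_normal[OF aE]]
      orbit_kernel_finite_index[OF aE finite_orbit[OF bounded oc a y]] by blast
  then have "T t (T \<one>\<^bsub>G\<^esub> a) = T \<one>\<^bsub>G\<^esub> a" using t by blast
  then show ?thesis using aE by (simp add: T_one)
qed

text \<open>A positive multiple of the atom lies below \<open>y\<close> and is therefore fixed; all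
  positive vectors below the atom are multiples of it.\<close>

lemma atom_in_fixed_band:
  assumes G: "\<And>N. N \<lhd> G \<Longrightarrow> N \<noteq> carrier G \<Longrightarrow> infinite (carrier (G Mod N))"
    and bounded: "bounded_representation G E T" and oc: "order_continuous_norm E"
    and y: "quasi_interior_fixed_point G E T y" and a: "atom E a"
  shows "a \<in> fixed_band"
proof -
  have a: "minimal_positive E a" using a by (rule atom_imp_minimal_positive)
  then have aE: "a \<in> carrier E" "0 \<sqsubseteq> a" by (auto simp: minimal_positive_def)
  have qi: "quasi_interior E y" and fix_y: "\<And>t. t \<in> carrier G \<Longrightarrow> T t y = y"
    using y by (auto simp: quasi_interior_fixed_point_def)
  have yE: "y \<in> carrier E" using qi by (simp add: quasi_interior_def pos_cone_def)
  obtain c where c: "c > 0" "c *\<^sub>R a \<sqsubseteq> y" using minimal_positive_le_quasi_interior[OF a qi] .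
  have Ta: "T t a = a" if "t \<in> carrier G" for t
  proof -
    have "T t (c *\<^sub>R a) = c *\<^sub>R a"
      using atom_fixed[OF G bounded oc minimal_positive_scaleR[OF a c(1)] c(2) yE fix_y that] .
    then show ?thesis using c aE that by (simp add: T_scaleR)
  qed
  show ?thesis
  proof (rule fixed_bandI)
    fix z t assume z: "z \<in> carrier E" "0 \<sqsubseteq> z" "z \<sqsubseteq> modulus E a" and t: "t \<in> carrier G"
    then have "z \<sqsubseteq> a" using aE by (simp add: modulus_of_nonneg)
    then obtain k where "z = k *\<^sub>R a" using minimal_positiveD[OF a z(1,2)] by blast
    then show "T t z = z" using t aE Ta by (simp add: T_scaleR)
  qed (rule aE)
qed

theorem trivial_action:
  assumes G: "\<And>N. N \<lhd> G \<Longrightarrow> N \<noteq> carrier G \<Longrightarrow> infinite (carrier (G Mod N))"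
    and bounded: "bounded_representation G E T" and oc: "order_continuous_norm E"
    and atomic: "atomic E" and y: "quasi_interior_fixed_point G E T y"
    and t: "t \<in> carrier G" and x: "x \<in> carrier E"
  shows "T t x = x"
proof -
  have "band E hull {a. atom E a} \<subseteq> fixed_band"
    using atom_in_fixed_band[OF G bounded oc y] by (intro hull_minimal band_fixed_band) auto
  then have "fixed_band = carrier E"
    using atomic fixed_band_carrier by (auto simp: atomic_def)
  then show ?thesis using x t by (rule T_eq_of_fixed_band)
qed

end

subsection \<open>Finite-dimensional permutation representations\<close>

text \<open>A copy of \<real>^I inside the ambient space, as lattice carriers must be subspaces of
  it.\<close>

locale coordinate_system =
  fixes I :: "'i set" and e :: "'i \<Rightarrow> 'v::real_vector"
  assumes finite_I: "finite I" and inj_e: "inj_on e I" and independent_e: "independent (e ` I)"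
begin

text \<open>Here \<open>real_vector.representation\<close> is the coefficient function of a basis,
  not a group representation.\<close>

definition coord :: "'v \<Rightarrow> 'i \<Rightarrow> real" where
  "coord x i = real_vector.representation (e ` I) x (e i)"

definition combination :: "('i \<Rightarrow> real) \<Rightarrow> 'v" where
  "combination f = (\<Sum>i\<in>I. f i *\<^sub>R e i)"

text \<open>The 1-norm is invariant under permutations of the coordinates, so these act
  isometrically.\<close>

definition V :: "'v normed_order" where
  "V = \<lparr>carrier = span (e ` I), eq = (=), le = (\<lambda>x y. \<forall>i\<in>I. coord x i \<le> coord y i),
    nrm = (\<lambda>x. \<Sum>i\<in>I. \<bar>coord x i\<bar>)\<rparr>"

lemma carrier_V: "carrier V = span (e ` I)"
  and eq_V: "x .=\<^bsub>V\<^esub> y \<longleftrightarrow> x = y"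
  and le_V: "x \<sqsubseteq>\<^bsub>V\<^esub> y \<longleftrightarrow> (\<forall>i\<in>I. coord x i \<le> coord y i)"
  and nrm_V: "nrm V x = (\<Sum>i\<in>I. \<bar>coord x i\<bar>)"
  by (simp_all add: V_def)

lemma subspace_V: "subspace (carrier V)"
  by (simp add: carrier_V)

lemmas V_closed [simp] = subspace_0[OF subspace_V] subspace_add[OF subspace_V]
  subspace_diff[OF subspace_V] subspace_neg[OF subspace_V] subspace_scale[OF subspace_V]

lemma e_closed [simp]: "i \<in> I \<Longrightarrow> e i \<in> carrier V"
  by (simp add: carrier_V span_base)

lemma combination_closed [simp]: "combination f \<in> carrier V"
  by (auto simp: combination_def intro: subspace_sum[OF subspace_V])

lemma coord_add [simp]:
  "x \<in> carrier V \<Longrightarrow> y \<in> carrier V \<Longrightarrow> coord (x + y) i = coord x i + coord y i"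
  by (simp add: coord_def carrier_V real_vector.representation_add[OF independent_e])

lemma coord_scaleR [simp]: "x \<in> carrier V \<Longrightarrow> coord (c *\<^sub>R x) i = c * coord x i"
  by (simp add: coord_def carrier_V real_vector.representation_scale[OF independent_e])

lemma coord_diff [simp]:
  "x \<in> carrier V \<Longrightarrow> y \<in> carrier V \<Longrightarrow> coord (x - y) i = coord x i - coord y i"
  using coord_add[of "x - y" y i] by simp

lemma coord_0 [simp]: "coord 0 i = 0"
  using coord_scaleR[of 0 0 i] by simp

lemma coord_uminus [simp]: "x \<in> carrier V \<Longrightarrow> coord (- x) i = - coord x i"
  using coord_scaleR[of x "-1" i] by simp

lemma coord_e: "i \<in> I \<Longrightarrow> j \<in> I \<Longrightarrow> coord (e i) j = (if i = j then 1 else 0)"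
  using inj_e by (auto simp: coord_def real_vector.representation_basis[OF independent_e] inj_on_def)

lemma coord_sum:
  "finite J \<Longrightarrow> (\<And>j. j \<in> J \<Longrightarrow> f j \<in> carrier V) \<Longrightarrow> coord (sum f J) i = (\<Sum>j\<in>J. coord (f j) i)"
proof (induction J rule: finite_induct)
  case (insert j J)
  then show ?case using subspace_sum[OF subspace_V, of J f] by simp
qed simp

lemma coord_combination [simp]: "i \<in> I \<Longrightarrow> coord (combination f) i = f i"
  using finite_I by (simp add: combination_def coord_sum coord_e if_distrib sum.delta cong: if_cong)

lemma combination_coord [simp]: 
  assumes "x \<in> carrier V"
  shows "combination (coord x) = x"
proof -
  have "(\<Sum>b\<in>e ` I. real_vector.representation (e ` I) x b *\<^sub>R b) = x"
    using assms finite_I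
    by (intro real_vector.sum_representation_eq[OF independent_e]) (auto simp: carrier_V)
  then show ?thesis
    by (simp add: combination_def coord_def sum.reindex[OF inj_e])
qed

lemma combination_cong: "(\<And>i. i \<in> I \<Longrightarrow> f i = g i) \<Longrightarrow> combination f = combination g"
  by (simp add: combination_def)

lemma V_eqI:
  "x \<in> carrier V \<Longrightarrow> y \<in> carrier V \<Longrightarrow> (\<And>i. i \<in> I \<Longrightarrow> coord x i = coord y i) \<Longrightarrow> x = y"
  by (metis combination_coord combination_cong)

section \<open>The coordinate space as a Banach lattice\<close>

lemma partial_order_V: "partial_order V"
proof
  show "(.=\<^bsub>V\<^esub>) = (=)" by (simp add: V_def)
  show "x .=\<^bsub>V\<^esub> y" if "x \<sqsubseteq>\<^bsub>V\<^esub> y" "y \<sqsubseteq>\<^bsub>V\<^esub> x" "x \<in> carrier V" "y \<in> carrier V" for x y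
    unfolding eq_V using that by (intro V_eqI antisym) (auto simp: le_V)
qed (auto simp: eq_V le_V intro: order_trans)

lemma lattice_V: "lattice V"
proof -
  interpret partial_order V by (rule partial_order_V)
  show ?thesis
  proof
    fix x y assume xy: "x \<in> carrier V" "y \<in> carrier V"
    have "least V (combination (\<lambda>i. max (coord x i) (coord y i))) (Upper V {x, y})"
      using xy by (auto simp: least_def Upper_def le_V)
    then show "\<exists>s. least V s (Upper V {x, y})" ..
    have "greatest V (combination (\<lambda>i. min (coord x i) (coord y i))) (Lower V {x, y})"
      using xy by (auto simp: greatest_def Lower_def le_V)
    then show "\<exists>s. greatest V s (Lower V {x, y})" ..
  qed
qed

text \<open>The modulus is an abstract join; it is compared with the vector of absolute values,
  which bounds \<open>x\<close> and \<open>- x\<close>.\<close>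

lemma coord_modulus [simp]:
  assumes "x \<in> carrier V" "i \<in> I"
  shows "coord (modulus V x) i = \<bar>coord x i\<bar>"
proof -
  interpret lattice V by (rule lattice_V)
  have m: "modulus V x \<in> carrier V" "x \<sqsubseteq>\<^bsub>V\<^esub> modulus V x" "- x \<sqsubseteq>\<^bsub>V\<^esub> modulus V x"
    using assms by (simp_all add: modulus_def join_left join_right)
  have "modulus V x \<sqsubseteq>\<^bsub>V\<^esub> combination (\<lambda>i. \<bar>coord x i\<bar>)"
    unfolding modulus_def using assms by (intro join_le) (auto simp: le_V)
  then show ?thesis
    using m assms unfolding le_V by (fastforce intro!: antisym simp: abs_le_iff)
qed

lemma abs_coord_le_nrm: "i \<in> I \<Longrightarrow> \<bar>coord x i\<bar> \<le> nrm V x"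
  unfolding nrm_V using finite_I by (intro member_le_sum) auto

lemma complete_V:
  fixes \<sigma> :: "nat \<Rightarrow> 'v"
  assumes \<sigma>: "\<And>n. \<sigma> n \<in> carrier V"
    and cauchy: "\<forall>\<epsilon>>0. \<exists>N. \<forall>m\<ge>N. \<forall>n\<ge>N. nrm V (\<sigma> m - \<sigma> n) < \<epsilon>"
  shows "\<exists>x\<in>carrier V. (\<lambda>n. nrm V (\<sigma> n - x)) \<longlonglongrightarrow> 0"
proof -
  have "convergent (\<lambda>n. coord (\<sigma> n) i)" if i: "i \<in> I" for i
  proof (rule real_Cauchy_convergent, rule metric_CauchyI)
    fix \<epsilon> :: real assume "\<epsilon> > 0"
    then obtain N where N: "\<forall>m\<ge>N. \<forall>n\<ge>N. nrm V (\<sigma> m - \<sigma> n) < \<epsilon>" using cauchy by blast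
    have "dist (coord (\<sigma> m) i) (coord (\<sigma> n) i) < \<epsilon>" if "m \<ge> N" "n \<ge> N" for m n
      using abs_coord_le_nrm[OF i, of "\<sigma> m - \<sigma> n"] N that \<sigma> by (fastforce simp: dist_real_def)
    then show "\<exists>N. \<forall>m\<ge>N. \<forall>n\<ge>N. dist (coord (\<sigma> m) i) (coord (\<sigma> n) i) < \<epsilon>" by blast
  qed
  then obtain L where L: "\<And>i. i \<in> I \<Longrightarrow> (\<lambda>n. coord (\<sigma> n) i) \<longlonglongrightarrow> L i"
    unfolding convergent_def by metis
  have "(\<lambda>n. \<Sum>i\<in>I. \<bar>coord (\<sigma> n) i - L i\<bar>) \<longlonglongrightarrow> (\<Sum>i\<in>I. \<bar>L i - L i\<bar>)"
    by (intro tendsto_intros L)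
  then have "(\<lambda>n. nrm V (\<sigma> n - combination L)) \<longlonglongrightarrow> 0"
    using \<sigma> by (simp add: nrm_V)
  then show ?thesis by (intro bexI[of _ "combination L"]) auto
qed

lemma banach_lattice_V: "banach_lattice V"
proof -
  interpret lattice V by (rule lattice_V)
  show ?thesis
  proof
    show "nrm V x = 0 \<longleftrightarrow> x = 0" if "x \<in> carrier V" for x
    proof
      assume "nrm V x = 0"
      then show "x = 0"
        using that finite_I by (intro V_eqI) (auto simp: nrm_V sum_nonneg_eq_0_iff)
    qed (simp add: nrm_V)
    show "nrm V (x + y) \<le> nrm V x + nrm V y" if "x \<in> carrier V" "y \<in> carrier V" for x y
      using that by (auto simp: nrm_V sum.distrib[symmetric] intro!: sum_mono)
    show "nrm V x \<le> nrm V y"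
      if "x \<in> carrier V" "y \<in> carrier V" "modulus V x \<sqsubseteq>\<^bsub>V\<^esub> modulus V y" for x y
      using that by (auto simp: nrm_V le_V intro!: sum_mono)
    show "nrm V (c *\<^sub>R x) = \<bar>c\<bar> * nrm V x" if "x \<in> carrier V" for x c
      using that by (simp add: nrm_V abs_mult sum_distrib_left)
  qed (auto simp: subspace_V le_V mult_left_mono intro: complete_V)
qed

lemma atom_e:
  assumes i: "i \<in> I"
  shows "atom V (e i)"
proof -
  have "principal_ideal V (e i) = span {e i}"
  proof (intro equalityI subsetI)
    fix x assume "x \<in> principal_ideal V (e i)"
    then obtain c where x: "x \<in> carrier V" "modulus V x \<sqsubseteq>\<^bsub>V\<^esub> c *\<^sub>R e i"
      by (auto simp: principal_ideal_def)
    have "coord x j = 0" if "j \<in> I" "j \<noteq> i" for j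
      using x i that by (auto simp: le_V coord_e dest!: bspec[of _ _ j])
    then have "x = coord x i *\<^sub>R e i"
      using x i by (intro V_eqI) (auto simp: coord_e)
    then show "x \<in> span {e i}" by (metis span_base span_scale singletonI)
  next
    fix x assume "x \<in> span {e i}"
    then obtain c where "x = c *\<^sub>R e i" by (auto simp: span_singleton)
    then show "x \<in> principal_ideal V (e i)"
      using i by (auto simp: principal_ideal_def le_V coord_e abs_mult intro!: exI[of _ "\<bar>c\<bar>"])
  qed
  moreover have "independent {e i}"
    using independent_e i by (rule_tac independent_mono) auto
  ultimately have "dim (principal_ideal V (e i)) = 1"
    using real_vector.dim_eq_card_independent[of "{e i}"] by simp
  then show ?thesis using i by (auto simp: atom_def pos_cone_def le_V coord_e)
qed

text \<open>A band is a subspace, and the atoms \<open>e i\<close> already span the carrier.\<close>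

lemma atomic_V: "atomic V"
proof -
  have "band V (carrier V)"
    using subspace_V by (auto simp: band_def order_ideal_def)
  then have "band V hull {a. atom V a} \<subseteq> carrier V"
    by (intro hull_minimal) (auto simp: atom_def pos_cone_def)
  moreover have "carrier V \<subseteq> B" if "band V B" "{a. atom V a} \<subseteq> B" for B
  proof -
    have "subspace B" using that by (simp add: band_def order_ideal_def)
    moreover have "e ` I \<subseteq> B" using that atom_e by auto
    ultimately show ?thesis unfolding carrier_V by (rule span_minimal[rotated])
  qed
  ultimately show ?thesis by (auto simp: atomic_def hull_def)
qed

lemma directed_lower_bound:
  assumes "D \<noteq> {}" and dir: "\<forall>x\<in>D. \<forall>y\<in>D. \<exists>z\<in>D. z \<sqsubseteq>\<^bsub>V\<^esub> x \<and> z \<sqsubseteq>\<^bsub>V\<^esub> y"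
    and "finite F" "F \<subseteq> D"
  shows "\<exists>z\<in>D. \<forall>x\<in>F. z \<sqsubseteq>\<^bsub>V\<^esub> x"
  using assms(3,4)
proof (induction F rule: finite_induct)
  case empty
  then show ?case using assms by auto
next
  case (insert x F)
  then obtain z where "z \<in> D" "\<forall>x\<in>F. z \<sqsubseteq>\<^bsub>V\<^esub> x" by auto
  moreover obtain w where "w \<in> D" "w \<sqsubseteq>\<^bsub>V\<^esub> z" "w \<sqsubseteq>\<^bsub>V\<^esub> x" using dir insert.prems \<open>z \<in> D\<close> by blast
  ultimately show ?case by (intro bexI[of _ w]) (auto simp: le_V intro: order_trans)
qed

lemma order_continuous_norm_V: "order_continuous_norm V"
  unfolding order_continuous_norm_def
proof (intro allI impI)
  fix D and \<epsilon> :: real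
  assume D: "D \<subseteq> carrier V" "D \<noteq> {}"
    and dir: "\<forall>x\<in>D. \<forall>y\<in>D. \<exists>z\<in>D. z \<sqsubseteq>\<^bsub>V\<^esub> x \<and> z \<sqsubseteq>\<^bsub>V\<^esub> y"
    and inf: "greatest V 0 (Lower V D)" and \<epsilon>: "\<epsilon> > 0"
  have nonneg: "0 \<le> coord x i" if "x \<in> D" "i \<in> I" for x i
    using inf D that by (auto simp: greatest_def Lower_def le_V)
  \<comment> \<open>The summand 1 covers empty \<open>I\<close> and makes the final estimate
    strict.\<close>
  define \<delta> where "\<delta> = \<epsilon> / (real (card I) + 1)"
  have \<delta>: "\<delta> > 0" using \<epsilon> by (simp add: \<delta>_def)
  \<comment> \<open>Otherwise \<open>\<delta> *\<^sub>R e i\<close> would be a lower bound of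
    \<open>D\<close> not below the infimum 0.\<close>
  have "\<exists>x\<in>D. coord x i < \<delta>" if i: "i \<in> I" for i
  proof (rule ccontr)
    assume *: "\<not> (\<exists>x\<in>D. coord x i < \<delta>)"
    have "\<delta> *\<^sub>R e i \<in> Lower V D"
      using * i nonneg by (intro Lower_memI) (auto simp: le_V coord_e not_less)
    then have "\<delta> *\<^sub>R e i \<sqsubseteq>\<^bsub>V\<^esub> 0" using inf by (auto simp: greatest_def)
    then show False using i \<delta> by (auto simp: le_V coord_e dest!: bspec[of _ _ i])
  qed
  then obtain f where f: "\<And>i. i \<in> I \<Longrightarrow> f i \<in> D \<and> coord (f i) i < \<delta>" by metis
  obtain z where z: "z \<in> D" "\<forall>x\<in>f ` I. z \<sqsubseteq>\<^bsub>V\<^esub> x"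
    using directed_lower_bound[OF D(2) dir, of "f ` I"] finite_I f by auto
  have "nrm V y < \<epsilon>" if y: "y \<in> D" "y \<sqsubseteq>\<^bsub>V\<^esub> z" for y
  proof -
    have "\<bar>coord y i\<bar> \<le> \<delta>" if i: "i \<in> I" for i
    proof -
      have "coord y i \<le> coord z i" "coord z i \<le> coord (f i) i" using y z i by (auto simp: le_V)
      then show ?thesis using f[OF i] nonneg[OF y(1) i] by linarith
    qed
    then have "nrm V y \<le> (\<Sum>i\<in>I. \<delta>)" unfolding nrm_V by (rule sum_mono)
    also have "\<dots> < \<epsilon>" using \<epsilon> by (simp add: \<delta>_def field_simps)
    finally show ?thesis .
  qed
  then show "\<exists>x\<in>D. \<forall>y\<in>D. y \<sqsubseteq>\<^bsub>V\<^esub> x \<longrightarrow> nrm V y < \<epsilon>" using z(1) by blast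
qed

text \<open>Each coordinate is bounded by the norm, so the principal ideal is already the whole
  carrier.\<close>

lemma quasi_interior_ones: "quasi_interior V (combination (\<lambda>_. 1))"
proof -
  have "carrier V \<subseteq> principal_ideal V (combination (\<lambda>_. 1))"
    using abs_coord_le_nrm 
    by (auto simp: principal_ideal_def le_V nrm_V intro!: exI[of _ "nrm V _"] sum_nonneg)
  then show ?thesis
    by (force simp: quasi_interior_def dense_in_def pos_cone_def le_V nrm_V)
qed

section \<open>Coordinate permutations and the representation induced by a group action\<close>

definition permute :: "('i \<Rightarrow> 'i) \<Rightarrow> 'v \<Rightarrow> 'v" where
  "permute \<pi> x = combination (\<lambda>i. coord x (\<pi> i))"

lemma permute_closed [simp]: "permute \<pi> x \<in> carrier V"
  by (simp add: permute_def)

lemma coord_permute [simp]: "i \<in> I \<Longrightarrow> coord (permute \<pi> x) i = coord x (\<pi> i)"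
  by (simp add: permute_def)

lemma nrm_permute: 
  assumes "bij_betw \<pi> I I"
  shows "nrm V (permute \<pi> x) = nrm V x"
  using sum.reindex_bij_betw[OF assms, of "\<lambda>i. \<bar>coord x i\<bar>"] by (simp add: nrm_V)

lemma bounded_operator_permute:
  assumes "bij_betw \<pi> I I"
  shows "bounded_operator V (permute \<pi>)"
  unfolding bounded_operator_def
  using nrm_permute[OF assms] by (auto intro!: V_eqI exI[of _ 1])

lemma operator_norm_permute:
  assumes "bij_betw \<pi> I I"
  shows "operator_norm V (permute \<pi>) \<le> 1"
  unfolding operator_norm_def
proof (rule cSUP_least)
  have "0 \<in> {x \<in> carrier V. nrm V x \<le> 1}" by (simp add: nrm_V)
  then show "{x \<in> carrier V. nrm V x \<le> 1} \<noteq> {}" by blast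
qed (simp add: nrm_permute[OF assms])

end

locale coordinate_action = coordinate_system I e + G: group G
  for I :: "'i set" and e :: "'i \<Rightarrow> 'v::real_vector" and G :: "('g, 'm) monoid_scheme" +
  fixes \<phi> :: "'g \<Rightarrow> 'i \<Rightarrow> 'i"
  assumes action_closed: "t \<in> carrier G \<Longrightarrow> i \<in> I \<Longrightarrow> \<phi> t i \<in> I"
    and action_one: "i \<in> I \<Longrightarrow> \<phi> \<one>\<^bsub>G\<^esub> i = i"
    and action_mult:
      "t \<in> carrier G \<Longrightarrow> s \<in> carrier G \<Longrightarrow> i \<in> I \<Longrightarrow> \<phi> (t \<otimes>\<^bsub>G\<^esub> s) i = \<phi> t (\<phi> s i)"
begin

text \<open>Precomposing coordinates reverses products; the inverse restores the order and sends
  \<open>e i\<close> to \<open>e (\<phi> t i)\<close>.\<close>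

definition T :: "'g \<Rightarrow> 'v \<Rightarrow> 'v" where
  "T t = permute (\<phi> (inv\<^bsub>G\<^esub> t))"

lemma action_inv: "t \<in> carrier G \<Longrightarrow> i \<in> I \<Longrightarrow> \<phi> (inv\<^bsub>G\<^esub> t) (\<phi> t i) = i"
  and action_inv': "t \<in> carrier G \<Longrightarrow> i \<in> I \<Longrightarrow> \<phi> t (\<phi> (inv\<^bsub>G\<^esub> t) i) = i"
  by (simp_all add: action_mult[symmetric] action_one)

lemma bij_betw_action: "t \<in> carrier G \<Longrightarrow> bij_betw (\<phi> t) I I"
  by (rule bij_betw_byWitness[where f' = "\<phi> (inv\<^bsub>G\<^esub> t)"])
    (auto simp: action_inv action_inv' action_closed)

lemma representation_T: "representation G V T"
  unfolding representation_def invertible_operator_def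
proof (intro conjI ballI exI)
  fix t assume t: "t \<in> carrier G"
  show "bounded_operator V (T t)" "bounded_operator V (T (inv\<^bsub>G\<^esub> t))"
    using t unfolding T_def by (auto intro: bounded_operator_permute bij_betw_action)
  show "T (inv\<^bsub>G\<^esub> t) (T t x) = x" "T t (T (inv\<^bsub>G\<^esub> t) x) = x" if "x \<in> carrier V" for x
    using t that by (auto simp: T_def action_closed action_inv action_inv' intro!: V_eqI)
  fix s x assume "s \<in> carrier G"
  then show "T (t \<otimes>\<^bsub>G\<^esub> s) x = T t (T s x)"
    using t by (auto simp: T_def G.inv_mult_group action_mult action_closed intro!: V_eqI)
qed

lemma positive_representation_T: "positive_representation G V T"
  unfolding positive_representation_def
  using representation_T by (auto simp: pos_cone_def T_def le_V action_closed)

lemma bounded_representation_T: "bounded_representation G V T"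
  unfolding bounded_representation_def T_def
  using representation_T
  by (auto simp: T_def[abs_def] bdd_above_def
      intro!: exI[of _ 1] operator_norm_permute bij_betw_action)

lemma fixed_point_T: "quasi_interior_fixed_point G V T (combination (\<lambda>_. 1))"
  unfolding quasi_interior_fixed_point_def
  using quasi_interior_ones by (auto simp: T_def action_closed intro!: V_eqI)

lemma T_e:
  assumes "t \<in> carrier G" "i \<in> I"
  shows "T t (e i) = e (\<phi> t i)"
  using assms by (intro V_eqI) 
    (auto simp: T_def action_closed coord_e action_inv action_inv' dest: arg_cong[of _ _ "\<phi> t"])

end

subsection \<open>The equivalence\<close>

text \<open>A basis of the ambient space is infinite, so it has subsets of every finite
  cardinality.\<close>

lemma independent_injection_exists:
  assumes "\<not> (\<exists>B :: 'v::real_vector set. finite B \<and> span B = UNIV)" and I: "finite I"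
  obtains e :: "'i \<Rightarrow> 'v::real_vector" where "inj_on e I" "independent (e ` I)"
proof -
  obtain B :: "'v set" where B: "independent B" "UNIV \<subseteq> span B"
    by (rule maximal_independent_subset[of UNIV])
  then have "span B = UNIV" by auto
  then have "infinite B" using assms(1) by blast
  then obtain C where C: "C \<subseteq> B" "finite C" "card C = card I"
    using infinite_arbitrarily_large by metis
  then obtain e where "bij_betw e I C" using I finite_same_card_bij by metis
  moreover have "independent C" using independent_mono[OF B(1) C(1)] .
  ultimately show ?thesis using that[of e] by (simp add: bij_betw_def)
qed

text \<open>\<open>G\<close> acts on the finite quotient by left multiplication with cosets. An
  element \<open>t\<close> outside \<open>N\<close> moves the unit coset, so its operator moves the
  corresponding basis vector.\<close>

lemma (in group) nontrivial_representation_of_finite_index: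
  assumes N: "N \<lhd> G" "N \<noteq> carrier G" "finite (carrier (G Mod N))"
    and universe: "\<not> (\<exists>B :: 'v::real_vector set. finite B \<and> span B = UNIV)"
  obtains E :: "'v::real_vector normed_order" and T y t x
  where "banach_lattice E" "atomic E" "order_continuous_norm E" "positive_representation G E T"
    "bounded_representation G E T" "quasi_interior_fixed_point G E T y"
    "t \<in> carrier G" "x \<in> carrier E" "T t x \<noteq> x"
proof -
  interpret N: normal N G by fact
  interpret Q: group "G Mod N" by (rule N.factorgroup_is_group)
  obtain e :: "'a set \<Rightarrow> 'v" where e: "inj_on e (carrier (G Mod N))" "independent (e ` carrier (G Mod N))"
    using independent_injection_exists[OF universe N(3)] .
  define \<phi> where "\<phi> t c = (N #> t) \<otimes>\<^bsub>G Mod N\<^esub> c" for t c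
  have coset: "N #> t \<in> carrier (G Mod N)" if "t \<in> carrier G" for t
    using that by (auto simp: carrier_FactGroup)
  have one: "N #> \<one> = \<one>\<^bsub>G Mod N\<^esub>" using coset_mult_one[OF N.subset] by simp
  have mult: "N #> (t \<otimes> s) = (N #> t) \<otimes>\<^bsub>G Mod N\<^esub> (N #> s)" if "t \<in> carrier G" "s \<in> carrier G" for t s
    using hom_mult[OF N.r_coset_hom_Mod that] .
  interpret coordinate_action "carrier (G Mod N)" e G \<phi>
  proof
    fix t s i assume "t \<in> carrier G" "s \<in> carrier G" "i \<in> carrier (G Mod N)"
    then show "\<phi> (t \<otimes> s) i = \<phi> t (\<phi> s i)"
      using mult coset Q.m_assoc by (simp add: \<phi>_def del: mult_FactGroup)
  qed (use N(3) e coset one Q.m_closed Q.l_one in \<open>auto simp: \<phi>_def simp del: mult_FactGroup one_FactGroup\<close>)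
  obtain t where t: "t \<in> carrier G" "t \<notin> N" using N(2) N.subset by auto
  have "\<phi> t \<one>\<^bsub>G Mod N\<^esub> = N #> t"
    using coset[OF t(1)] Q.r_one by (simp add: \<phi>_def del: mult_FactGroup one_FactGroup)
  moreover have "N #> t \<noteq> \<one>\<^bsub>G Mod N\<^esub>"
    using t rcos_self[OF t(1) N.subgroup_axioms] by auto
  ultimately have "T t (e \<one>\<^bsub>G Mod N\<^esub>) \<noteq> e \<one>\<^bsub>G Mod N\<^esub>"
    using T_e[OF t(1) Q.one_closed] inj_onD[OF e(1)] coset[OF t(1)] Q.one_closed by metis
  then show ?thesis
    using that[OF banach_lattice_V atomic_V order_continuous_norm_V positive_representation_T
        bounded_representation_T fixed_point_T t(1) e_closed[OF Q.one_closed]] by blast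
qed

(* The ambient real vector space 'v plays the role of the universe from which the Banach lattices
   are taken (see Defs). It is arbitrary, except that it must be large enough to contain
   every finite-dimensional one. *)
theorem theorem2p2:
  fixes G :: "('g, 'm) monoid_scheme"
  assumes "group G"
    and universe: "\<not> (\<exists>B :: 'v::real_vector set. finite B \<and> span B = UNIV)"
  shows "(\<forall>N. N \<lhd> G \<longrightarrow> N \<noteq> carrier G \<longrightarrow> infinite (carrier (G Mod N)))
    \<longleftrightarrow>
    (\<forall>(E :: 'v normed_order) T.
        banach_lattice E \<longrightarrow> atomic E \<longrightarrow> order_continuous_norm E \<longrightarrow>
        positive_representation G E T \<longrightarrow> bounded_representation G E T \<longrightarrow>
        (\<exists>y. quasi_interior_fixed_point G E T y) \<longrightarrow>
        (\<forall>t\<in>carrier G. \<forall>x\<in>carrier E. T t x = x))"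
    (is "?infinite_index \<longleftrightarrow> ?trivial")
proof
  assume G: ?infinite_index
  show ?trivial
  proof (intro allI impI ballI)
    fix E :: "'v normed_order" and T t x
    assume E: "banach_lattice E" "atomic E" "order_continuous_norm E"
      and T: "positive_representation G E T" "bounded_representation G E T"
      and "\<exists>y. quasi_interior_fixed_point G E T y" and tx: "t \<in> carrier G" "x \<in> carrier E"
    then obtain y where y: "quasi_interior_fixed_point G E T y" by blast
    interpret positive_action E G T
      using E(1) \<open>group G\<close> T(1) by (simp add: positive_action_def positive_action_axioms_def)
    show "T t x = x"
      by (rule trivial_action[OF _ T(2) E(3,2) y tx]) (use G in blast)
  qed
next
  assume trivial: ?trivial
  show ?infinite_index
  proof (intro allI impI notI)
    fix N assume N: "N \<lhd> G" "N \<noteq> carrier G" "finite (carrier (G Mod N))"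
    obtain E :: "'v normed_order" and T y t x
      where "banach_lattice E" "atomic E" "order_continuous_norm E" "positive_representation G E T"
        "bounded_representation G E T" "quasi_interior_fixed_point G E T y"
        "t \<in> carrier G" "x \<in> carrier E" "T t x \<noteq> x"
      using group.nontrivial_representation_of_finite_index[OF \<open>group G\<close> N universe] .
    then show False using trivial by blast
  qed
qed

end
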